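(* Let $N\ge2$ and consider the adiabatic search Hamiltonian $H(s)$ with the linear interpolation $f(s)=s$. For $T>0$ let $\Psi(s,T)$ solve $\frac{i\hbar}{T}\partial_s\Psi=H(s)\Psi$ with $\Psi(0,T)=|\sigma\rangle$, and let $\varepsilon(T)=\arccos|\langle m|\Psi(1,T)\rangle|$. Then, for fixed $N$ and $T\to\infty$, $$\varepsilon(T)\le\frac{\hbar}{\mathsf E T}\,\frac{2\sqrt{N-1}}{N}+O\!\left(\frac1{T^2}\right).$$ Moreover, for every constant $C>0$, the validity time $T_{\rm val}$ and validity error $\tilde\varepsilon$ associated with this interpolation (defined in the context) are $$T_{\rm val}=\frac{\hbar}{\mathsf E}\,\frac C3\left|2(N-1)-17\,\frac{N-1}{N}\right|,\qquad\tilde\varepsilon=\frac{6}{C\,\big|(2N-17)\sqrt{N-1}\big|}.$$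
   Context: Adiabatic search: $\hbar,\mathsf E>0$ are constants; $|0\rangle,\dots,|N-1\rangle$ is an orthonormal basis of $\mathbb C^N$, $|m\rangle$ is one of these basis vectors (the marked item), $|\sigma\rangle=N^{-1/2}\sum_x|x\rangle$, and $$H(s)=\mathsf E\big[(1-f(s))(1-|\sigma\rangle\langle\sigma|)+f(s)(1-|m\rangle\langle m|)\big],\quad s\in[0,1],$$ where $f$ is monotonically increasing with $f(0)=0$, $f(1)=1$. The span of $|\sigma\rangle,|m\rangle$ is invariant. Let $|m_\perp\rangle=\sqrt{\tfrac{N}{N-1}}\,(|\sigma\rangle-N^{-1/2}|m\rangle)$. On this subspace $H(s)/\mathsf E$ has eigenvalues $\frac12(1\mp\Delta(s))$ with $$\Delta(s)=\sqrt{1-4\tfrac{N-1}{N}f(s)(1-f(s))},$$ and eigenvectors $\phi_0=\sin\frac\theta2|m\rangle+\cos\frac\theta2|m_\perp\rangle$ (lower eigenvalue) and $\phi_1=\cos\frac\theta2|m\rangle-\sin\frac\theta2|m_\perp\rangle$, where $\theta(s)\in[0,\pi]$ and $\cos\theta(s)=\big(2\frac{N-1}{N}(1-f(s))-1\big)/\Delta(s)$. So $\phi_0(0)=|\sigma\rangle$, $\phi_0(1)=|m\rangle$. Put $\lambda_{10}(s)=\langle\phi_1(s),\dot\phi_0(s)\rangle/\Delta(s)$ and $J_0(1)=\int_0^1|\langle\phi_1(s),\dot\phi_0(s)\rangle|^2/\Delta(s)\,ds$ (dot $=d/ds$). For a constant $C>0$ the validity time and validity error of the leading-order relation are defined by $$T_{\rm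 val}=\frac{\hbar}{\mathsf E}\,C\left|J_0(1)+\frac{\dot\lambda_{10}(1)}{\lambda_{10}(1)}\right|,\qquad\tilde\varepsilon=\frac{\hbar}{\mathsf E\,T_{\rm val}}\,2|\lambda_{10}(1)|.$$ *)

theory Defs
  imports "HOL-Analysis.Analysis" "HOL-Library.Landau_Symbols"
begin

text \<open>The library inner product on \<open>complex ^ 'n\<close> is the real-valued one, so the Hermitian
  product is defined here; it is conjugate-linear in its first argument.\<close>

definition cinner :: "complex ^ 'n \<Rightarrow> complex ^ 'n \<Rightarrow> complex" where
  "cinner x y = (\<Sum>i\<in>UNIV. cnj (x $ i) * y $ i)"

definition ketbra :: "complex ^ 'n \<Rightarrow> complex ^ 'n \<Rightarrow> complex ^ 'n ^ 'n" where
  "ketbra x y = (\<chi> i j. x $ i * cnj (y $ j))"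

text \<open>A family of \<open>CARD('n)\<close> orthonormal vectors is automatically a basis.\<close>

definition orthonormal_basis :: "('n::finite \<Rightarrow> complex ^ 'n) \<Rightarrow> bool" where
  "orthonormal_basis e \<longleftrightarrow> (\<forall>x y. cinner (e x) (e y) = (if x = y then 1 else 0))"

text \<open>Throughout, \<open>e\<close> is the orthonormal basis, \<open>m\<close> the label of the marked item,
  and \<open>f\<close> the interpolation function on \<open>[0,1]\<close>; \<open>N = CARD('n)\<close>.\<close>

definition uniform_state :: "('n::finite \<Rightarrow> complex ^ 'n) \<Rightarrow> complex ^ 'n" where
  "uniform_state e = (1 / sqrt (real CARD('n))) *\<^sub>R (\<Sum>x\<in>UNIV. e x)"

definition search_hamiltonian ::
  "real \<Rightarrow> ('n::finite \<Rightarrow> complex ^ 'n) \<Rightarrow> 'n \<Rightarrow> (real \<Rightarrow> real) \<Rightarrow> real \<Rightarrow> complex ^ 'n ^ 'n" where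
  "search_hamiltonian E e m f s =
     E *\<^sub>R ((1 - f s) *\<^sub>R (mat 1 - ketbra (uniform_state e) (uniform_state e))
           + f s *\<^sub>R (mat 1 - ketbra (e m) (e m)))"

text \<open>\<open>psi\<close> solves \<open>(i hbar / T) psi' = H psi\<close> on \<open>[0,1]\<close> (one-sided derivatives at the
  endpoints) with the uniform state as initial value.\<close>

definition search_evolution ::
  "real \<Rightarrow> real \<Rightarrow> ('n::finite \<Rightarrow> complex ^ 'n) \<Rightarrow> 'n \<Rightarrow> (real \<Rightarrow> real) \<Rightarrow> real
     \<Rightarrow> (real \<Rightarrow> complex ^ 'n) \<Rightarrow> bool" where
  "search_evolution hbar E e m f T psi \<longleftrightarrow>
     psi 0 = uniform_state e \<and>
     (\<forall>s\<in>{0..1}. \<exists>D. (psi has_vector_derivative D) (at s within {0..1}) \<and>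
        (\<i> * complex_of_real hbar / complex_of_real T) *s D
          = search_hamiltonian E e m f s *v psi s)"

definition search_error ::
  "('n::finite \<Rightarrow> complex ^ 'n) \<Rightarrow> 'n \<Rightarrow> (real \<Rightarrow> complex ^ 'n) \<Rightarrow> real" where
  "search_error e m psi = arccos (cmod (cinner (e m) (psi 1)))"

definition m_perp :: "('n::finite \<Rightarrow> complex ^ 'n) \<Rightarrow> 'n \<Rightarrow> complex ^ 'n" where
  "m_perp e m = sqrt (real CARD('n) / (real CARD('n) - 1)) *\<^sub>R
     (uniform_state e - (1 / sqrt (real CARD('n))) *\<^sub>R e m)"

definition gap :: "nat \<Rightarrow> (real \<Rightarrow> real) \<Rightarrow> real \<Rightarrow> real" where
  "gap N f s = sqrt (1 - 4 * ((real N - 1) / real N) * f s * (1 - f s))"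

definition mixing_angle :: "nat \<Rightarrow> (real \<Rightarrow> real) \<Rightarrow> real \<Rightarrow> real" where
  "mixing_angle N f s = arccos ((2 * ((real N - 1) / real N) * (1 - f s) - 1) / gap N f s)"

definition phi0 ::
  "('n::finite \<Rightarrow> complex ^ 'n) \<Rightarrow> 'n \<Rightarrow> (real \<Rightarrow> real) \<Rightarrow> real \<Rightarrow> complex ^ 'n" where
  "phi0 e m f s = sin (mixing_angle CARD('n) f s / 2) *\<^sub>R e m
                + cos (mixing_angle CARD('n) f s / 2) *\<^sub>R m_perp e m"

definition phi1 ::
  "('n::finite \<Rightarrow> complex ^ 'n) \<Rightarrow> 'n \<Rightarrow> (real \<Rightarrow> real) \<Rightarrow> real \<Rightarrow> complex ^ 'n" where
  "phi1 e m f s = cos (mixing_angle CARD('n) f s / 2) *\<^sub>R e m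
                - sin (mixing_angle CARD('n) f s / 2) *\<^sub>R m_perp e m"

text \<open>Derivatives in \<open>s\<close> are taken within \<open>[0,1]\<close>: \<^const>\<open>mixing_angle\<close> reaches \<open>pi\<close> at
  the right endpoint, where only the one-sided derivative is meaningful.\<close>

definition coupling ::
  "('n::finite \<Rightarrow> complex ^ 'n) \<Rightarrow> 'n \<Rightarrow> (real \<Rightarrow> real) \<Rightarrow> real \<Rightarrow> complex" where
  "coupling e m f s =
     cinner (phi1 e m f s) (vector_derivative (phi0 e m f) (at s within {0..1}))"

definition lambda10 ::
  "('n::finite \<Rightarrow> complex ^ 'n) \<Rightarrow> 'n \<Rightarrow> (real \<Rightarrow> real) \<Rightarrow> real \<Rightarrow> complex" where
  "lambda10 e m f s = coupling e m f s / complex_of_real (gap CARD('n) f s)"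

definition J0_at_1 ::
  "('n::finite \<Rightarrow> complex ^ 'n) \<Rightarrow> 'n \<Rightarrow> (real \<Rightarrow> real) \<Rightarrow> real" where
  "J0_at_1 e m f = integral {0..1} (\<lambda>s. (cmod (coupling e m f s))\<^sup>2 / gap CARD('n) f s)"

definition validity_time ::
  "real \<Rightarrow> real \<Rightarrow> real \<Rightarrow> ('n::finite \<Rightarrow> complex ^ 'n) \<Rightarrow> 'n \<Rightarrow> (real \<Rightarrow> real) \<Rightarrow> real" where
  "validity_time hbar E C e m f = hbar / E * C *
     cmod (complex_of_real (J0_at_1 e m f)
           + vector_derivative (lambda10 e m f) (at 1 within {0..1}) / lambda10 e m f 1)"

definition validity_error ::
  "real \<Rightarrow> real \<Rightarrow> real \<Rightarrow> ('n::finite \<Rightarrow> complex ^ 'n) \<Rightarrow> 'n \<Rightarrow> (real \<Rightarrow> real) \<Rightarrow> real" where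
  "validity_error hbar E C e m f =
     hbar / (E * validity_time hbar E C e m f) * (2 * cmod (lambda10 e m f 1))"

end

theory Submission
  imports Defs
begin

text \<open>In the instantaneous eigenbasis the amplitudes \<open>\<alpha>\<close>, \<open>\<beta>\<close> of the two-dimensional invariant
  subspace satisfy \<open>\<beta>' = - \<kappa> \<alpha> - \<i> \<tau> \<mu>\<^sub>1 \<beta>\<close> with \<open>\<tau> = E T / hbar\<close> and \<open>\<kappa> = k / D\<^sup>2\<close>, where \<open>D\<close> is the
  gap and \<open>k = sqrt (N - 1) / N\<close>. Instead of integrating by parts twice against the dynamical phase,
  one adds to \<open>\<beta>\<close> correctors \<open>- \<i> \<eta> \<alpha> / \<tau>\<close> and \<open>y \<alpha> / \<tau>\<^sup>2\<close> with \<open>\<eta> = \<kappa> / D = \<lambda>\<^sub>1\<^sub>0\<close> and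
  \<open>y = \<eta>' / D\<close>. The first makes the defect of the phase-rotated amplitude \<open>O(1 / \<tau>)\<close>, whence
  \<open>\<beta> = O(1 / \<tau>)\<close>; this and the second make it \<open>O(1 / \<tau>\<^sup>2)\<close>. Only the corrector's
  boundary terms, of size \<open>\<eta> 0 / \<tau> + \<eta> 1 / \<tau> = 2 k / \<tau>\<close>, remain at leading order.\<close>

section \<open>Adiabatic error of a two-level system\<close>

lemma norm_diff_le_vector_derivative_bound:
  fixes f :: "real \<Rightarrow> 'a::real_normed_vector"
  assumes "a \<le> b"
    and f: "\<And>s. s \<in> {a..b} \<Longrightarrow> (f has_vector_derivative f' s) (at s within {a..b})"
    and B: "\<And>s. s \<in> {a..b} \<Longrightarrow> norm (f' s) \<le> B"
  shows "norm (f b - f a) \<le> B * (b - a)"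
proof -
  have on: "onorm (\<lambda>h. h *\<^sub>R f' s) \<le> B" if "s \<in> {a..b}" for s
  proof (rule onorm_le)
    show "norm (h *\<^sub>R f' s) \<le> B * norm h" for h :: real
      using mult_right_mono[OF B[OF that], of "\<bar>h\<bar>"] by (simp add: mult.commute)
  qed
  have "norm (f b - f a) \<le> B * norm (b - a)"
    by (rule differentiable_bound[OF convex_real_interval(5)[of a b], where f' = "\<lambda>s h. h *\<^sub>R f' s"])
      (use f on \<open>a \<le> b\<close> in \<open>auto simp: has_vector_derivative_def\<close>)
  then show ?thesis using \<open>a \<le> b\<close> by simp
qed

lemma has_vector_derivative_cis_of_real:
  assumes "(\<phi> has_real_derivative d) (at s within S)"
  shows "((\<lambda>t. cis (\<phi> t)) has_vector_derivative (\<i> * of_real d * cis (\<phi> s))) (at s within S)"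
proof -
  have "((\<lambda>t. exp (\<i> * of_real (\<phi> t))) has_vector_derivative
      (\<i> * of_real d * exp (\<i> * of_real (\<phi> s)))) (at s within S)"
  proof -
    have 1: "((\<lambda>t. \<i> * of_real (\<phi> t)) has_vector_derivative \<i> * of_real d) (at s within S)"
      by (intro has_vector_derivative_mult_right has_vector_derivative_of_real assms)
    have 2: "(exp has_field_derivative exp (\<i> * of_real (\<phi> s))) (at (\<i> * of_real (\<phi> s)))"
      by (rule DERIV_exp)
    show ?thesis
      using field_vector_diff_chain_within[OF 1 has_field_derivative_at_within[OF 2]]
      by (simp add: o_def)
  qed
  then show ?thesis by (simp add: cis_conv_exp)
qed

text \<open>The unimodular integrating factor \<open>cis (\<phi> s)\<close>, with
  \<open>\<phi>\<close> a primitive of \<open>\<mu>\<close>, removes the phase term. The resulting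
  bound is uniform in \<open>\<mu>\<close>, which later carries the large factor
  \<open>\<tau>\<close>.\<close>

lemma rotating_phase_bound:
  fixes G R :: "real \<Rightarrow> complex" and \<mu> :: "real \<Rightarrow> real"
  assumes ode: "\<And>s. s \<in> {0..1} \<Longrightarrow>
      (G has_vector_derivative (R s - \<i> * of_real (\<mu> s) * G s)) (at s within {0..1})"
    and \<mu>: "continuous_on {0..1} \<mu>"
    and B: "\<And>s. s \<in> {0..1} \<Longrightarrow> cmod (R s) \<le> B"
    and t: "t \<in> {0..1}"
  shows "cmod (G t) \<le> cmod (G 0) + B"
proof -
  define \<phi> where "\<phi> = (\<lambda>u. integral {0..u} \<mu>)"
  have \<phi>: "(\<phi> has_real_derivative \<mu> s) (at s within {0..1})" if "s \<in> {0..1}" for s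
    unfolding \<phi>_def using integral_has_real_derivative[OF \<mu> that] .
  have d: "((\<lambda>s. cis (\<phi> s) * G s) has_vector_derivative cis (\<phi> s) * R s) (at s within {0..t})"
    if "s \<in> {0..t}" for s
  proof (rule has_vector_derivative_within_subset[where S = "{0..1}"])
    have s: "s \<in> {0..1}" using that t by auto
    show "((\<lambda>s. cis (\<phi> s) * G s) has_vector_derivative cis (\<phi> s) * R s) (at s within {0..1})"
      using has_vector_derivative_mult[OF has_vector_derivative_cis_of_real[OF \<phi>[OF s]] ode[OF s]]
      by (simp add: algebra_simps)
  qed (use t in auto)
  have "cmod (cis (\<phi> t) * G t - cis (\<phi> 0) * G 0) \<le> B * (t - 0)"
    by (rule norm_diff_le_vector_derivative_bound[OF _ d])
       (use t B in \<open>auto simp: norm_mult\<close>)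
  moreover have "0 \<le> B" using order_trans[OF norm_ge_zero B[OF t]] .
  then have "B * (t - 0) \<le> B" using t by (simp add: mult_left_le)
  moreover have "cmod (cis (\<phi> t) * G t) \<le> cmod (cis (\<phi> 0) * G 0)
      + cmod (cis (\<phi> t) * G t - cis (\<phi> 0) * G 0)"
    by (rule norm_triangle_sub)
  ultimately show ?thesis by (simp add: norm_mult)
qed

text \<open>The coefficient matrix is anti-Hermitian: a real skew coupling plus an imaginary
  diagonal.\<close>

lemma sum_cmod_squares_constant:
  fixes \<alpha> \<beta> :: "real \<Rightarrow> complex"
  assumes \<alpha>: "\<And>s. s \<in> {0..1} \<Longrightarrow> (\<alpha> has_vector_derivative
        (of_real (\<kappa> s) * \<beta> s - \<i> * of_real (\<mu>\<^sub>0 s) * \<alpha> s)) (at s within {0..1})"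
    and \<beta>: "\<And>s. s \<in> {0..1} \<Longrightarrow> (\<beta> has_vector_derivative
        (- of_real (\<kappa> s) * \<alpha> s - \<i> * of_real (\<mu>\<^sub>1 s) * \<beta> s)) (at s within {0..1})"
    and t: "t \<in> {0..1}"
  shows "(cmod (\<alpha> t))\<^sup>2 + (cmod (\<beta> t))\<^sup>2 = (cmod (\<alpha> 0))\<^sup>2 + (cmod (\<beta> 0))\<^sup>2"
proof -
  have sq: "(cmod z)\<^sup>2 = Re z * Re z + Im z * Im z" for z
    by (simp add: cmod_power2 power2_eq_square[of "Re z"] power2_eq_square[of "Im z"])
  define g where "g = (\<lambda>s. (cmod (\<alpha> s))\<^sup>2 + (cmod (\<beta> s))\<^sup>2)"
  have "(g has_real_derivative 0) (at s within {0..1})" if s: "s \<in> {0..1}" for s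
  proof -
    have Re_Im_sq: "((\<lambda>s. Re (h s) * Re (h s) + Im (h s) * Im (h s)) has_real_derivative
        2 * (Re (h s) * Re d + Im (h s) * Im d)) (at s within {0..1})"
      if "(h has_vector_derivative d) (at s within {0..1})" for h d
      by (rule DERIV_cong[OF DERIV_add[OF DERIV_mult DERIV_mult]])
        (rule has_field_derivative_Re[OF that] has_field_derivative_Im[OF that]
          | simp add: algebra_simps)+
    show ?thesis
      unfolding g_def sq
      by (rule DERIV_cong[OF DERIV_add[OF Re_Im_sq[OF \<alpha>[OF s]] Re_Im_sq[OF \<beta>[OF s]]]])
        (simp add: algebra_simps)
  qed
  then have "norm (g t - g 0) \<le> 0 * (t - 0)"
    using t by (intro norm_diff_le_vector_derivative_bound[where f' = "\<lambda>_. 0"])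
      (auto simp: has_real_derivative_iff_has_vector_derivative
        intro: has_vector_derivative_within_subset[of _ _ _ "{0..1}"])
  then show ?thesis by (simp add: g_def)
qed

text \<open>Here \<open>X\<close> is \<open>\<eta> / \<tau>\<close>, \<open>M\<^sub>0\<close> and
  \<open>M\<^sub>1\<close> are \<open>\<tau> * \<mu>\<^sub>0\<close> and
  \<open>\<tau> * \<mu>\<^sub>1\<close>, and \<open>M\<^sub>1 * X - M\<^sub>0 * X\<close> is
  \<open>\<kappa>\<close>. The coupling term in \<open>a\<close> is absorbed because
  \<open>a\<close> and \<open>b\<close> rotate at different rates; what is left is small or belongs
  to the phase of the corrected amplitude.\<close>

lemma first_order_cancellation:
  fixes X X' M\<^sub>0 M\<^sub>1 a b :: complex
  shows "- (M\<^sub>1 * X - M\<^sub>0 * X) * a - \<i> * M\<^sub>1 * b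
      - (\<i> * X * ((M\<^sub>1 * X - M\<^sub>0 * X) * b - \<i> * M\<^sub>0 * a) + \<i> * X' * a)
    = - \<i> * X' * a - \<i> * X * (M\<^sub>1 * X - M\<^sub>0 * X) * b - \<i> * M\<^sub>1 * (b - \<i> * X * a)"
  by (simp add: algebra_simps)

text \<open>The same mechanism one order higher: \<open>g\<close> is the first corrected amplitude,
  \<open>Y\<close> is \<open>y / \<tau>\<^sup>2\<close>, and
  \<open>M\<^sub>1 * Y - M\<^sub>0 * Y\<close> is \<open>\<eta>' / \<tau>\<close>.\<close>

lemma second_order_cancellation:
  fixes X K Y Y' M\<^sub>0 M\<^sub>1 a b g :: complex
  shows "- \<i> * (M\<^sub>1 * Y - M\<^sub>0 * Y) * a - \<i> * X * K * b - \<i> * M\<^sub>1 * g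
      + (Y * (K * b - \<i> * M\<^sub>0 * a) + Y' * a)
    = Y' * a + Y * K * b - \<i> * X * K * b - \<i> * M\<^sub>1 * (g + Y * a)"
  by (simp add: algebra_simps)

text \<open>The cruder second conclusion serves twice: inside the proof of the first, and later for
  the quadratic term in the estimate of \<open>arccos\<close>.\<close>

lemma two_level_adiabatic_bound:
  fixes \<alpha> \<beta> :: "real \<Rightarrow> complex" and \<kappa> \<mu>\<^sub>0 \<mu>\<^sub>1 \<eta> \<eta>' y y' :: "real \<Rightarrow> real"
  assumes \<alpha>: "\<And>s. s \<in> {0..1} \<Longrightarrow> (\<alpha> has_vector_derivative
        (of_real (\<kappa> s) * \<beta> s - \<i> * of_real (\<tau> * \<mu>\<^sub>0 s) * \<alpha> s)) (at s within {0..1})"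
    and \<beta>: "\<And>s. s \<in> {0..1} \<Longrightarrow> (\<beta> has_vector_derivative
        (- of_real (\<kappa> s) * \<alpha> s - \<i> * of_real (\<tau> * \<mu>\<^sub>1 s) * \<beta> s)) (at s within {0..1})"
    and init: "cmod (\<alpha> 0) = 1" "\<beta> 0 = 0"
    and \<eta>: "\<And>s. s \<in> {0..1} \<Longrightarrow> (\<eta> has_real_derivative \<eta>' s) (at s within {0..1})"
    and y: "\<And>s. s \<in> {0..1} \<Longrightarrow> (y has_real_derivative y' s) (at s within {0..1})"
    and \<kappa>_eq: "\<And>s. s \<in> {0..1} \<Longrightarrow> \<kappa> s = (\<mu>\<^sub>1 s - \<mu>\<^sub>0 s) * \<eta> s"
    and \<eta>'_eq: "\<And>s. s \<in> {0..1} \<Longrightarrow> \<eta>' s = (\<mu>\<^sub>1 s - \<mu>\<^sub>0 s) * y s"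
    and \<mu>: "continuous_on {0..1} \<mu>\<^sub>1"
    and B: "\<And>s. s \<in> {0..1} \<Longrightarrow>
        \<bar>\<kappa> s\<bar> \<le> B \<and> \<bar>\<eta> s\<bar> \<le> B \<and> \<bar>\<eta>' s\<bar> \<le> B \<and> \<bar>y s\<bar> \<le> B \<and> \<bar>y' s\<bar> \<le> B"
    and \<tau>: "\<tau> > 0"
  shows "cmod (\<beta> 1) \<le> (\<bar>\<eta> 0\<bar> + \<bar>\<eta> 1\<bar>) / \<tau> + (3 * B + B\<^sup>2 + B\<^sup>2 * (3 * B + B\<^sup>2)) / \<tau>\<^sup>2"
    and "cmod (\<beta> 1) \<le> (3 * B + B\<^sup>2) / \<tau>"
proof -
  have B0: "0 \<le> B" using B[of 0] by auto
  have norm1: "(cmod (\<alpha> s))\<^sup>2 + (cmod (\<beta> s))\<^sup>2 = 1" if "s \<in> {0..1}" for s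
    using sum_cmod_squares_constant[OF \<alpha> \<beta> that] init by simp
  have a1: "cmod (\<alpha> s) \<le> 1" and b1: "cmod (\<beta> s) \<le> 1" if "s \<in> {0..1}" for s
  proof -
    have "(cmod (\<alpha> s))\<^sup>2 \<le> 1\<^sup>2" "(cmod (\<beta> s))\<^sup>2 \<le> 1\<^sup>2"
      using norm1[OF that] zero_le_power2[of "cmod (\<alpha> s)"] zero_le_power2[of "cmod (\<beta> s)"]
      unfolding one_power2 by linarith+
    then show "cmod (\<alpha> s) \<le> 1" "cmod (\<beta> s) \<le> 1"
      using power2_le_imp_le zero_le_one by blast+
  qed
  define G1 where "G1 = (\<lambda>s. \<beta> s - \<i> * of_real (\<eta> s / \<tau>) * \<alpha> s)"
  define R1 where "R1 = (\<lambda>s. - \<i> * of_real (\<eta>' s / \<tau>) * \<alpha> s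
      - \<i> * of_real (\<eta> s / \<tau>) * of_real (\<kappa> s) * \<beta> s)"
  have G1: "(G1 has_vector_derivative (R1 s - \<i> * of_real (\<tau> * \<mu>\<^sub>1 s) * G1 s)) (at s within {0..1})"
    if s: "s \<in> {0..1}" for s
  proof -
    \<comment> \<open>In this form the goal becomes a literal instance of the abstract cancellation
      identity.\<close>
    have \<kappa>_split: "complex_of_real (\<kappa> s)
        = of_real (\<tau> * \<mu>\<^sub>1 s) * of_real (\<eta> s / \<tau>) - of_real (\<tau> * \<mu>\<^sub>0 s) * of_real (\<eta> s / \<tau>)"
    proof -
      have "\<kappa> s = \<tau> * \<mu>\<^sub>1 s * (\<eta> s / \<tau>) - \<tau> * \<mu>\<^sub>0 s * (\<eta> s / \<tau>)"
        using \<tau> \<kappa>_eq[OF s] by (simp add: algebra_simps)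
      then show ?thesis by (simp only: flip: of_real_mult of_real_diff)
    qed
    show ?thesis
      unfolding G1_def
      by (rule has_vector_derivative_eq_rhs[OF has_vector_derivative_diff[OF \<beta>[OF s]
          has_vector_derivative_mult[OF has_vector_derivative_mult_right[OF
            has_vector_derivative_of_real[OF DERIV_cdivide[OF \<eta>[OF s]]]] \<alpha>[OF s]]]])
        (simp only: R1_def \<kappa>_split, rule first_order_cancellation)
  qed
  have R1: "cmod (R1 s) \<le> (B + B\<^sup>2) / \<tau>" if s: "s \<in> {0..1}" for s
  proof -
    have "cmod (R1 s) \<le> \<bar>\<eta>' s\<bar> / \<tau> * cmod (\<alpha> s) + \<bar>\<eta> s\<bar> * \<bar>\<kappa> s\<bar> / \<tau> * cmod (\<beta> s)"
      unfolding R1_def using \<tau> by (intro order_trans[OF norm_triangle_ineq4]) (simp add: norm_mult norm_divide)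
    also have "\<dots> \<le> B / \<tau> * 1 + B * B / \<tau> * 1"
      using B[OF s] a1[OF s] b1[OF s] \<tau> B0
      by (intro add_mono mult_mono divide_right_mono) auto
    finally show ?thesis by (simp add: power2_eq_square add_divide_distrib)
  qed
  \<comment> \<open>Of the three \<open>B\<close>, one comes from \<open>G1 0\<close>, one from the
    bound on \<open>R1\<close>, and one from removing the corrector again.\<close>
  have \<beta>_le: "cmod (\<beta> s) \<le> (3 * B + B\<^sup>2) / \<tau>" if s: "s \<in> {0..1}" for s
  proof -
    have "cmod (G1 s) \<le> cmod (G1 0) + (B + B\<^sup>2) / \<tau>"
      by (rule rotating_phase_bound[OF G1 _ R1 s]) (auto intro: continuous_on_mult_left \<mu>)
    moreover have "cmod (G1 0) \<le> B / \<tau>"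
      using B[of 0] \<tau> init by (simp add: G1_def norm_mult norm_divide divide_right_mono)
    moreover have "cmod (\<beta> s) \<le> cmod (G1 s) + \<bar>\<eta> s\<bar> / \<tau> * cmod (\<alpha> s)"
      using norm_triangle_ineq[of "G1 s" "\<i> * of_real (\<eta> s / \<tau>) * \<alpha> s"] \<tau>
      by (simp add: G1_def norm_mult norm_divide)
    moreover have "\<bar>\<eta> s\<bar> / \<tau> * cmod (\<alpha> s) \<le> B / \<tau> * 1"
      using B[OF s] a1[OF s] \<tau> B0 by (intro mult_mono divide_right_mono) auto
    ultimately show ?thesis by (simp add: add_divide_distrib)
  qed
  then show "cmod (\<beta> 1) \<le> (3 * B + B\<^sup>2) / \<tau>" by simp
  define G2 where "G2 = (\<lambda>s. G1 s + of_real (y s / \<tau>\<^sup>2) * \<alpha> s)"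
  define R2 where "R2 = (\<lambda>s. of_real (y' s / \<tau>\<^sup>2) * \<alpha> s + of_real (y s / \<tau>\<^sup>2) * of_real (\<kappa> s) * \<beta> s
      - \<i> * of_real (\<eta> s / \<tau>) * of_real (\<kappa> s) * \<beta> s)"
  have G2: "(G2 has_vector_derivative (R2 s - \<i> * of_real (\<tau> * \<mu>\<^sub>1 s) * G2 s)) (at s within {0..1})"
    if s: "s \<in> {0..1}" for s
  proof -
    have \<eta>'_split: "complex_of_real (\<eta>' s / \<tau>)
        = of_real (\<tau> * \<mu>\<^sub>1 s) * of_real (y s / \<tau>\<^sup>2) - of_real (\<tau> * \<mu>\<^sub>0 s) * of_real (y s / \<tau>\<^sup>2)"
    proof -
      have "\<eta>' s / \<tau> = \<tau> * \<mu>\<^sub>1 s * (y s / \<tau>\<^sup>2) - \<tau> * \<mu>\<^sub>0 s * (y s / \<tau>\<^sup>2)"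
        using \<tau> \<eta>'_eq[OF s] by (simp add: field_simps power2_eq_square)
      then show ?thesis by (simp only: flip: of_real_mult of_real_diff)
    qed
    show ?thesis
      unfolding G2_def
      by (rule has_vector_derivative_eq_rhs[OF has_vector_derivative_add[OF G1[OF s]
          has_vector_derivative_mult[OF has_vector_derivative_of_real[OF DERIV_cdivide[OF y[OF s]]]
            \<alpha>[OF s]]]])
        (simp only: R1_def R2_def \<eta>'_split, rule second_order_cancellation)
  qed
  have R2: "cmod (R2 s) \<le> (B + B\<^sup>2 + B\<^sup>2 * (3 * B + B\<^sup>2)) / \<tau>\<^sup>2" if s: "s \<in> {0..1}" for s
  proof -
    have "cmod (R2 s) \<le> \<bar>y' s\<bar> / \<tau>\<^sup>2 * cmod (\<alpha> s) + \<bar>y s\<bar> * \<bar>\<kappa> s\<bar> / \<tau>\<^sup>2 * cmod (\<beta> s)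
        + \<bar>\<eta> s\<bar> * \<bar>\<kappa> s\<bar> / \<tau> * cmod (\<beta> s)"
      unfolding R2_def using \<tau>
      by (intro order_trans[OF norm_triangle_ineq4] add_mono order_trans[OF norm_triangle_ineq])
        (simp_all add: norm_mult norm_divide norm_power abs_mult)
    \<comment> \<open>The term in \<open>\<eta> * \<kappa> * \<beta>\<close> carries only one factor
      \<open>1 / \<tau>\<close>; the second is supplied by \<open>\<beta>_le\<close>.\<close>
    also have "\<dots> \<le> B / \<tau>\<^sup>2 * 1 + B * B / \<tau>\<^sup>2 * 1 + B * B / \<tau> * ((3 * B + B\<^sup>2) / \<tau>)"
      using B[OF s] a1[OF s] b1[OF s] \<beta>_le[OF s] \<tau> B0
      by (intro add_mono mult_mono divide_right_mono) auto
    also have "\<dots> = (B + B\<^sup>2 + B\<^sup>2 * (3 * B + B\<^sup>2)) / \<tau>\<^sup>2"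
      by (simp add: power2_eq_square add_divide_distrib[of _ _ "\<tau> * \<tau>"])
    finally show ?thesis .
  qed
  \<comment> \<open>The boundary values of \<open>y\<close> at \<open>0\<close> and \<open>1\<close>
    add \<open>2 * B\<close> to the constant of \<open>R2\<close>; those of \<open>\<eta>\<close>
    form the leading term.\<close>
  have "cmod (G2 1) \<le> cmod (G2 0) + (B + B\<^sup>2 + B\<^sup>2 * (3 * B + B\<^sup>2)) / \<tau>\<^sup>2"
    by (rule rotating_phase_bound[OF G2 _ R2]) (auto intro: continuous_on_mult_left \<mu>)
  moreover have "cmod (G2 0) \<le> \<bar>\<eta> 0\<bar> / \<tau> + B / \<tau>\<^sup>2"
  proof -
    have "cmod (G2 0) \<le> \<bar>\<eta> 0\<bar> / \<tau> + \<bar>y 0\<bar> / \<tau>\<^sup>2"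
      unfolding G2_def G1_def using \<tau> init
      by (intro order_trans[OF norm_triangle_ineq]) (simp add: norm_mult norm_divide norm_power)
    also have "\<dots> \<le> \<bar>\<eta> 0\<bar> / \<tau> + B / \<tau>\<^sup>2"
      using B[of 0] \<tau> by (intro add_mono divide_right_mono) auto
    finally show ?thesis .
  qed
  moreover have "cmod (\<beta> 1) \<le> cmod (G2 1) + \<bar>\<eta> 1\<bar> / \<tau> + B / \<tau>\<^sup>2"
  proof -
    have "\<beta> 1 = G2 1 + \<i> * of_real (\<eta> 1 / \<tau>) * \<alpha> 1 - of_real (y 1 / \<tau>\<^sup>2) * \<alpha> 1"
      by (simp add: G2_def G1_def)
    then have "cmod (\<beta> 1) \<le> cmod (G2 1) + \<bar>\<eta> 1\<bar> / \<tau> * cmod (\<alpha> 1) + \<bar>y 1\<bar> / \<tau>\<^sup>2 * cmod (\<alpha> 1)"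
      using norm_triangle_ineq4[of "G2 1 + \<i> * of_real (\<eta> 1 / \<tau>) * \<alpha> 1" "of_real (y 1 / \<tau>\<^sup>2) * \<alpha> 1"]
        norm_triangle_ineq[of "G2 1" "\<i> * of_real (\<eta> 1 / \<tau>) * \<alpha> 1"] \<tau>
      by (simp add: norm_mult norm_divide norm_power)
    also have "\<dots> \<le> cmod (G2 1) + \<bar>\<eta> 1\<bar> / \<tau> * 1 + B / \<tau>\<^sup>2 * 1"
      using B[of 1] a1[of 1] \<tau> B0 by (intro add_mono mult_mono divide_right_mono) auto
    finally show ?thesis by simp
  qed
  ultimately show "cmod (\<beta> 1) \<le> (\<bar>\<eta> 0\<bar> + \<bar>\<eta> 1\<bar>) / \<tau> + (3 * B + B\<^sup>2 + B\<^sup>2 * (3 * B + B\<^sup>2)) / \<tau>\<^sup>2"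
    by (simp add: add_divide_distrib)
qed

section \<open>Bounding an angle by its sine\<close>

lemma arctan_le_self:
  fixes x :: real
  assumes "0 \<le> x"
  shows "arctan x \<le> x"
proof -
  have "(\<lambda>x. x - arctan x) 0 \<le> (\<lambda>x. x - arctan x) x"
  proof (rule DERIV_nonneg_imp_nondecreasing[OF assms])
    fix t :: real
    have "((\<lambda>x. x - arctan x) has_real_derivative 1 - inverse (1 + t\<^sup>2)) (at t)"
      by (auto intro!: derivative_eq_intros)
    moreover have "0 \<le> 1 - inverse (1 + t\<^sup>2)" by (simp add: inverse_le_1_iff)
    ultimately show "\<exists>y. ((\<lambda>x. x - arctan x) has_real_derivative y) (at t) \<and> 0 \<le> y" by blast
  qed
  then show ?thesis by simp
qed

text \<open>For small \<open>b\<close> the angle is \<open>arctan (b / r)\<close>, at most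
  \<open>b / r\<close>, and \<open>r\<close> is at least \<open>1 - b\<^sup>2\<close>. For large
  \<open>b\<close> the right-hand side already exceeds every angle in the first quadrant.\<close>

lemma arccos_le_of_sum_squares:
  fixes r b :: real
  assumes "0 \<le> r" "0 \<le> b" "r\<^sup>2 + b\<^sup>2 = 1"
  shows "arccos r \<le> b + 8 * b\<^sup>2"
proof -
  have "r\<^sup>2 \<le> 1\<^sup>2" using assms zero_le_power2[of b] unfolding one_power2 by linarith
  then have r1: "r \<le> 1" by (rule power2_le_imp_le) simp
  have "b\<^sup>2 = 1 - r\<^sup>2" using assms by simp
  then have b_eq: "b = sqrt (1 - r\<^sup>2)" using assms(2) by (metis real_sqrt_unique)
  have b_sin: "sin (arccos r) = b" unfolding b_eq using assms(1) r1 by (intro sin_arccos_abs) simp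
  have x0: "0 \<le> arccos r" "arccos r \<le> pi / 2"
    using assms(1) r1 arccos_lbound arccos_le_pi2 by auto
  show ?thesis
  proof (cases "b < 1/2")
    case False
    \<comment> \<open>the constant 8 makes the right-hand side exceed \<open>pi / 2\<close> here\<close>
    then have "b * b \<ge> (1/2) * (1/2)" using assms(2) by (intro mult_mono) auto
    then have "b + 8 * b\<^sup>2 \<ge> 2" using False by (simp add: power2_eq_square)
    then show ?thesis using x0 pi_less_4 by linarith
  next
    case True
    have "b * b \<le> (1/2) * (1/2)" using True assms(2) by (intro mult_mono) auto
    then have b2: "b\<^sup>2 \<le> 1/4" by (simp add: power2_eq_square)
    then have "r \<noteq> 0" using assms(3) by auto
    then have "0 < r" using assms(1) by simp
    have "r * r \<le> r * 1" using assms(1) r1 by (intro mult_left_mono) auto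
    then have "1 - b\<^sup>2 \<le> r" using assms(3) by (simp add: power2_eq_square)
    then have "(1 - b\<^sup>2) * (b + 8 * b\<^sup>2) \<le> r * (b + 8 * b\<^sup>2)"
      using assms(2) by (intro mult_right_mono) auto
    moreover have "b \<le> (1 - b\<^sup>2) * (b + 8 * b\<^sup>2)"
    proof -
      have "b * b\<^sup>2 \<le> 1 * b\<^sup>2" "b\<^sup>2 * b\<^sup>2 \<le> (1/4) * b\<^sup>2"
        using True b2 by (intro mult_right_mono; simp)+
      moreover have "(1 - b\<^sup>2) * (b + 8 * b\<^sup>2) = b + 8 * b\<^sup>2 - b * b\<^sup>2 - 8 * (b\<^sup>2 * b\<^sup>2)"
        by (simp add: algebra_simps)
      ultimately show ?thesis using zero_le_power2[of b] by linarith
    qed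
    ultimately have "b / r \<le> b + 8 * b\<^sup>2" using \<open>0 < r\<close> by (simp add: divide_le_eq mult.commute)
    moreover have "arccos r \<noteq> pi / 2"
      using \<open>0 < r\<close> cos_arccos[of r] r1 cos_pi_half by force
    then have "arctan (tan (arccos r)) = arccos r" using x0 by (intro arctan_tan) (use pi_gt_zero in linarith)+
    then have "arccos r = arctan (b / r)" using assms(1) r1 by (simp add: tan_def b_sin)
    moreover have "arctan (b / r) \<le> b / r"
      using assms(2) \<open>0 < r\<close> by (intro arctan_le_self) simp
    ultimately show ?thesis by linarith
  qed
qed

section \<open>Gap and mixing angle of the linear interpolation\<close>

text \<open>\<open>c\<close> is the squared overlap of the uniform state with \<open>m_perp\<close>,
  and \<open>k = sqrt (c * (1 - c))\<close> is the product of its overlaps with the marked state and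
  \<open>m_perp\<close>. Keeping both as parameters lets the algebra run without unfolding
  \<open>N\<close>.\<close>

locale linear_interpolation =
  fixes N :: nat and c k :: real
  assumes N: "2 \<le> N"
    and c_def: "c = (real N - 1) / real N"
    and k_def: "k = sqrt (real N - 1) / real N"
begin

lemma c_bounds: "0 < c" "c < 1" and k_pos: "0 < k" and k_sq: "k\<^sup>2 = c * (1 - c)"
  using N by (auto simp: c_def k_def field_simps power2_eq_square)

text \<open>Completing the square around \<open>s = 1/2\<close> shows that the squared gap is at
  least \<open>1 - c = 1 / N\<close>.\<close>

lemma gap_sq: "(gap N (\<lambda>s. s) s)\<^sup>2 = 1 - 4 * c * s * (1 - s)"
  and gap_pos: "0 < gap N (\<lambda>s. s) s"
proof -
  have "1 - 4 * c * s * (1 - s) = (1 - c) + c * (1 - 2 * s)\<^sup>2"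
    by (simp add: algebra_simps power2_eq_square)
  moreover have "0 < (1 - c) + c * (1 - 2 * s)\<^sup>2"
    using c_bounds by (intro add_pos_nonneg) auto
  ultimately have "0 < 1 - 4 * c * s * (1 - s)" by simp
  then show "(gap N (\<lambda>s. s) s)\<^sup>2 = 1 - 4 * c * s * (1 - s)" "0 < gap N (\<lambda>s. s) s"
    by (simp_all add: gap_def c_def)
qed

lemma gap_nonzero: "gap N (\<lambda>s. s) s \<noteq> 0"
  using gap_pos[of s] by simp

lemma gap_has_real_derivative:
  "(gap N (\<lambda>s. s) has_real_derivative - 2 * (c * (1 - 2 * s)) / gap N (\<lambda>s. s) s) (at s within S)"
proof -
  have Q: "((\<lambda>s. 1 - 4 * c * s * (1 - s)) has_real_derivative - 4 * (c * (1 - 2 * s))) (at s within S)"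
    by (auto intro!: derivative_eq_intros simp: algebra_simps)
  have "0 < 1 - 4 * c * s * (1 - s)"
    using zero_less_power[OF gap_pos[of s], of 2] by (simp only: gap_sq)
  note sqrtQ = DERIV_chain2[OF DERIV_real_sqrt[OF this] Q]
  have "inverse g / 2 * (- 4 * a) = - 2 * a / g" for a g :: real
    by (simp add: field_simps)
  then have "((\<lambda>s. sqrt (1 - 4 * c * s * (1 - s))) has_real_derivative
      - 2 * (c * (1 - 2 * s)) / sqrt (1 - 4 * c * s * (1 - s))) (at s within S)"
    by (rule DERIV_cong[OF sqrtQ])
  then show ?thesis by (simp only: gap_def[abs_def] c_def)
qed

text \<open>The gap is the hypotenuse over the legs \<open>1 - 2 * c * (1 - s)\<close> and
  \<open>2 * k * (1 - s)\<close>, so it strictly exceeds the first leg in modulus unless the second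
  vanishes, which happens only at \<open>s = 1\<close>.\<close>

lemma angle_denominator_pos: "0 < gap N (\<lambda>s. s) s + 1 - 2 * c * (1 - s)"
proof (cases "s = 1")
  case False
  have "(gap N (\<lambda>s. s) s)\<^sup>2 = (1 - 2 * c * (1 - s))\<^sup>2 + (2 * k * (1 - s))\<^sup>2"
    by (simp add: gap_sq power_mult_distrib k_sq) (simp add: algebra_simps power2_eq_square)
  moreover have "0 < (2 * k * (1 - s))\<^sup>2" using False k_pos by simp
  ultimately have "\<bar>1 - 2 * c * (1 - s)\<bar>\<^sup>2 < (gap N (\<lambda>s. s) s)\<^sup>2" by simp
  then have "\<bar>1 - 2 * c * (1 - s)\<bar> < gap N (\<lambda>s. s) s"
    by (rule power_less_imp_less_base) (use gap_pos[of s] in simp)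
  then show ?thesis by linarith
qed (use gap_pos[of 1] in simp)

text \<open>Pythagoras for the same triangle, with the hypotenuse added to the first leg. It
  collapses the denominators in the two lemmas on the mixing angle that follow.\<close>

lemma angle_denominator_square:
  defines "r \<equiv> \<lambda>s. gap N (\<lambda>s. s) s + 1 - 2 * c * (1 - s)"
  shows "(r s)\<^sup>2 + (2 * k * (1 - s))\<^sup>2 = 2 * gap N (\<lambda>s. s) s * r s"
  using gap_sq[of s] by (simp add: r_def power_mult_distrib k_sq)
    (simp add: algebra_simps power2_eq_square)

text \<open>Unlike \<^const>\<open>arccos\<close>, this expression is differentiable up to \<open>s = 1\<close>.\<close>

lemma mixing_angle_arctan:
  assumes "s \<le> 1"
  shows "mixing_angle N (\<lambda>s. s) s
    = pi - 2 * arctan (2 * k * (1 - s) / (gap N (\<lambda>s. s) s + 1 - 2 * c * (1 - s)))"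
proof -
  \<comment> \<open>\<open>y / r\<close> is the tangent of half of \<open>pi\<close> minus the
    mixing angle: that supplementary angle has sine \<open>y / D\<close> and one plus its cosine is
    \<open>r / D\<close>.\<close>
  define D r y where "D = gap N (\<lambda>s. s) s" and "r = D + 1 - 2 * c * (1 - s)" and "y = 2 * k * (1 - s)"
  have r: "0 < r" and D: "0 < D" and ry: "r\<^sup>2 + y\<^sup>2 = 2 * D * r"
    using angle_denominator_pos[of s] gap_pos[of s] angle_denominator_square[of s]
    by (simp_all add: D_def r_def y_def)
  have y: "0 \<le> y" using assms k_pos by (simp add: y_def)
  have "cos (pi - 2 * arctan (y / r)) = 1 - 2 * (cos (arctan (y / r)))\<^sup>2"
    by (simp add: cos_diff cos_double_cos)
  also have "(cos (arctan (y / r)))\<^sup>2 = 1 / (1 + (y / r)\<^sup>2)"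
    by (simp add: cos_arctan power_divide)
  also have "\<dots> = r\<^sup>2 / (r\<^sup>2 + y\<^sup>2)" using r by (simp add: field_simps)
  also have "\<dots> = r / (2 * D)" using r D unfolding ry by (simp add: power2_eq_square)
  also have "1 - 2 * (r / (2 * D)) = (2 * c * (1 - s) - 1) / D"
    using D by (simp add: r_def field_simps)
  finally have "cos (pi - 2 * arctan (y / r)) = (2 * c * (1 - s) - 1) / D" .
  moreover have "0 \<le> arctan (y / r)" "arctan (y / r) < pi / 2"
    using y r arctan_ubound by auto
  ultimately have "arccos ((2 * c * (1 - s) - 1) / D) = pi - 2 * arctan (y / r)"
    by (intro arccos_unique) auto
  then show ?thesis
    by (simp add: mixing_angle_def D_def r_def y_def c_def)
qed

lemma mixing_angle_has_real_derivative:
  assumes "s \<in> {0..1}"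
  shows "(mixing_angle N (\<lambda>s. s) has_real_derivative 2 * (k / (gap N (\<lambda>s. s) s)\<^sup>2)) (at s within {0..1})"
proof -
  define D where "D = gap N (\<lambda>s. s)"
  define r where "r = (\<lambda>s. D s + 1 - 2 * c * (1 - s))"
  define y where "y = (\<lambda>s. 2 * k * (1 - s))"
  have r: "0 < r s" and D: "0 < D s" and ry: "(r s)\<^sup>2 + (y s)\<^sup>2 = 2 * D s * r s"
    using angle_denominator_pos[of s] gap_pos[of s] angle_denominator_square[of s]
    by (simp_all add: D_def r_def y_def)
  define r' where "r' = - 2 * (c * (1 - 2 * s)) / D s + 2 * c"
  have dr: "(r has_real_derivative r') (at s within {0..1})"
    unfolding r_def r'_def D_def by (auto intro!: derivative_eq_intros gap_has_real_derivative)
  have dy: "(y has_real_derivative - 2 * k) (at s within {0..1})"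
    unfolding y_def by (auto intro!: derivative_eq_intros)
  have "((\<lambda>t. pi - 2 * arctan (y t / r t)) has_real_derivative
      0 - 2 * (inverse (1 + (y s / r s)\<^sup>2) * ((- 2 * k * r s - y s * r') / (r s * r s))))
      (at s within {0..1})"
    using r by (intro DERIV_diff DERIV_const DERIV_cmult DERIV_chain2[OF DERIV_arctan]
      DERIV_divide dr dy) simp
  also have "0 - 2 * (inverse (1 + (y s / r s)\<^sup>2) * ((- 2 * k * r s - y s * r') / (r s * r s)))
      = 2 * (2 * k * r s + y s * r') / ((r s * r s) * (1 + (y s / r s)\<^sup>2))"
    by (simp add: inverse_eq_divide minus_divide_left mult.commute)
  also have "(r s * r s) * (1 + (y s / r s)\<^sup>2) = (r s)\<^sup>2 + (y s)\<^sup>2"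
    using r by (simp add: power_divide distrib_left power2_eq_square)
  also have "2 * k * r s + y s * r' = 2 * k * r s / D s"
  proof -
    \<comment> \<open>After multiplication by \<open>D s\<close>, and with \<open>D s * D s\<close>
      replaced by its quadratic, this is a polynomial identity in \<open>s\<close>, \<open>c\<close>
      and \<open>D s\<close>.\<close>
    have "D s * r s + (1 - s) * (D s * r') = r s"
    proof -
      have "D s * r' = - 2 * (c * (1 - 2 * s)) + 2 * c * D s"
        using D by (simp add: r'_def field_simps)
      moreover have "D s * D s = 1 - 4 * c * s * (1 - s)"
        using gap_sq[of s] by (simp add: D_def power2_eq_square)
      then have "D s * r s = 1 - 4 * c * s * (1 - s) + D s - 2 * c * (1 - s) * D s"
        by (simp add: r_def algebra_simps)
      ultimately show ?thesis by (simp only:) (simp add: r_def algebra_simps)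
    qed
    then have "2 * k * (D s * r s + (1 - s) * (D s * r')) = 2 * k * r s" by simp
    then have "D s * (2 * k * r s + y s * r') = 2 * k * r s"
      by (simp add: y_def algebra_simps)
    then show ?thesis using D by (simp add: field_simps)
  qed
  also have "2 * (2 * k * r s / D s) / ((r s)\<^sup>2 + (y s)\<^sup>2) = 2 * (k / (D s)\<^sup>2)"
    using r D unfolding ry by (simp add: power2_eq_square)
  finally show ?thesis
    unfolding D_def[symmetric]
    by (rule has_field_derivative_transform_within[where d = 1])
      (use assms mixing_angle_arctan in \<open>auto simp: D_def r_def y_def\<close>)
qed

text \<open>The vector \<open>(2 * c * (1 - s) - 1, 2 * k * (1 - s))\<close> has length equal to the
  gap, and \<open>s \<le> 1\<close> puts it in the closed upper half-plane, where
  \<open>arccos\<close> recovers the polar angle.\<close>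

lemma cos_mixing_angle: "s \<le> 1 \<Longrightarrow> cos (mixing_angle N (\<lambda>s. s) s) * gap N (\<lambda>s. s) s = 2 * c * (1 - s) - 1"
  and sin_mixing_angle: "s \<le> 1 \<Longrightarrow> sin (mixing_angle N (\<lambda>s. s) s) * gap N (\<lambda>s. s) s = 2 * k * (1 - s)"
proof -
  assume s: "s \<le> 1"
  define D v where "D = gap N (\<lambda>s. s) s" and "v = 2 * c * (1 - s) - 1"
  have D: "0 < D" using gap_pos by (simp add: D_def)
  have D2: "D\<^sup>2 = v\<^sup>2 + (2 * k * (1 - s))\<^sup>2"
    by (simp add: D_def v_def gap_sq power_mult_distrib k_sq) (simp add: algebra_simps power2_eq_square)
  have "\<bar>v\<bar>\<^sup>2 \<le> D\<^sup>2" unfolding D2 by simp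
  then have "\<bar>v\<bar> \<le> D" by (rule power2_le_imp_le) (use D in simp)
  then have v: "\<bar>v / D\<bar> \<le> 1" using D by simp
  have \<theta>: "mixing_angle N (\<lambda>s. s) s = arccos (v / D)"
    by (simp add: mixing_angle_def D_def v_def c_def)
  show "cos (mixing_angle N (\<lambda>s. s) s) * gap N (\<lambda>s. s) s = 2 * c * (1 - s) - 1"
    using v D unfolding \<theta> D_def[symmetric] v_def[symmetric] by (simp add: cos_arccos_abs)
  have "sqrt (1 - (v / D)\<^sup>2) = 2 * k * (1 - s) / D"
  proof (rule real_sqrt_unique)
    have "(2 * k * (1 - s))\<^sup>2 = D\<^sup>2 - v\<^sup>2" using D2 by simp
    then show "(2 * k * (1 - s) / D)\<^sup>2 = 1 - (v / D)\<^sup>2"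
      using D by (simp only: power_divide) (simp add: diff_divide_distrib)
  qed (use s D k_pos in simp)
  then show "sin (mixing_angle N (\<lambda>s. s) s) * gap N (\<lambda>s. s) s = 2 * k * (1 - s)"
    using v D unfolding \<theta> D_def[symmetric] by (simp add: sin_arccos_abs)
qed

lemma half_angle_relations:
  fixes s :: real
  defines "D \<equiv> gap N (\<lambda>s. s) s"
    and "p \<equiv> sin (mixing_angle N (\<lambda>s. s) s / 2)" and "q \<equiv> cos (mixing_angle N (\<lambda>s. s) s / 2)"
  assumes "s \<le> 1"
  shows "p\<^sup>2 + q\<^sup>2 = 1" "2 * (c * (1 - s)) = 1 + D * (q\<^sup>2 - p\<^sup>2)" "k * (1 - s) = D * (p * q)"
proof -
  show "p\<^sup>2 + q\<^sup>2 = 1" by (simp add: p_def q_def)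
  have "cos (mixing_angle N (\<lambda>s. s) s) = q\<^sup>2 - p\<^sup>2" "sin (mixing_angle N (\<lambda>s. s) s) = 2 * p * q"
    using cos_double[of "mixing_angle N (\<lambda>s. s) s / 2"] sin_double[of "mixing_angle N (\<lambda>s. s) s / 2"]
    by (simp_all add: p_def q_def)
  then have "(q\<^sup>2 - p\<^sup>2) * D = 2 * c * (1 - s) - 1" "2 * p * q * D = 2 * k * (1 - s)"
    using cos_mixing_angle[OF \<open>s \<le> 1\<close>] sin_mixing_angle[OF \<open>s \<le> 1\<close>]
    by (simp_all only: D_def)
  then show "2 * (c * (1 - s)) = 1 + D * (q\<^sup>2 - p\<^sup>2)" "k * (1 - s) = D * (p * q)"
    by (simp_all only: mult.commute mult.left_commute)
qed

text \<open>On the basis of marked state and \<open>m_perp\<close>, the Hamiltonian divided by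
  \<open>E\<close> is the symmetric matrix with diagonal \<open>c * (1 - s)\<close>,
  \<open>1 - c * (1 - s)\<close> and off-diagonal entry \<open>- k * (1 - s)\<close>. The four
  equations say that \<open>(p, q)\<close> and \<open>(q, - p)\<close> are its eigenvectors.\<close>

lemma eigenvector_relations:
  fixes s :: real
  defines "D \<equiv> gap N (\<lambda>s. s) s"
    and "p \<equiv> sin (mixing_angle N (\<lambda>s. s) s / 2)" and "q \<equiv> cos (mixing_angle N (\<lambda>s. s) s / 2)"
  assumes "s \<le> 1"
  shows "p * (c * (1 - s)) - q * (k * (1 - s)) = (1 - D) / 2 * p"
    and "q * (1 - c * (1 - s)) - p * (k * (1 - s)) = (1 - D) / 2 * q"
    and "q * (c * (1 - s)) + p * (k * (1 - s)) = (1 + D) / 2 * q"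
    and "p * (1 - c * (1 - s)) + q * (k * (1 - s)) = (1 + D) / 2 * p"
proof -
  have pq: "p\<^sup>2 + q\<^sup>2 = 1"
    and cu: "2 * (c * (1 - s)) = 1 + D * (q\<^sup>2 - p\<^sup>2)" and ku: "k * (1 - s) = D * (p * q)"
    using half_angle_relations[OF \<open>s \<le> 1\<close>] by (simp_all add: D_def p_def q_def)
  define C where "C = c * (1 - s)"
  have C: "C = (1 + D * (q\<^sup>2 - p\<^sup>2)) / 2" using cu by (simp add: C_def)
  \<comment> \<open>Inserting \<open>p\<^sup>2 + q\<^sup>2 = 1\<close> here turns all four goals
    into identities that hold without side relations.\<close>
  have D: "D = D * p\<^sup>2 + D * q\<^sup>2" using pq by (simp flip: distrib_left)
  have 1: "(1 - D) / 2 = (1 - (D * p\<^sup>2 + D * q\<^sup>2)) / 2" and 2: "(1 + D) / 2 = (1 + (D * p\<^sup>2 + D * q\<^sup>2)) / 2"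
    using D by simp_all
  show "p * (c * (1 - s)) - q * (k * (1 - s)) = (1 - D) / 2 * p"
    and "q * (1 - c * (1 - s)) - p * (k * (1 - s)) = (1 - D) / 2 * q"
    and "q * (c * (1 - s)) + p * (k * (1 - s)) = (1 + D) / 2 * q"
    and "p * (1 - c * (1 - s)) + q * (k * (1 - s)) = (1 + D) / 2 * p"
    unfolding C_def[symmetric] ku C 1 2 by (simp_all add: field_simps power2_eq_square)
qed

section \<open>Powers of the gap: the coupling integral and the correctors\<close>

lemma gap_has_real_derivative_centred:
  "(gap N (\<lambda>s. s) has_real_derivative 2 * (c * (2 * s - 1)) / gap N (\<lambda>s. s) s) (at s within S)"
  by (rule DERIV_cong[OF gap_has_real_derivative]) (simp add: algebra_simps)

lemma gap_sq_centred: "(gap N (\<lambda>s. s) s)\<^sup>2 = (1 - c) + c * (2 * s - 1)\<^sup>2"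
  by (simp add: gap_sq) (simp add: algebra_simps power2_eq_square)

text \<open>The integral defining \<open>J0_at_1\<close>, by an explicit primitive. It is odd about
  \<open>s = 1/2\<close>, so the integral is twice its value at \<open>1\<close>, where the gap is
  \<open>1\<close>; then \<open>c / (1 - c) = N - 1\<close>.\<close>

lemma coupling_integral:
  "((\<lambda>s. (k / (gap N (\<lambda>s. s) s)\<^sup>2)\<^sup>2 / gap N (\<lambda>s. s) s) has_integral (2 * (real N - 1) + c) / 3) {0..1}"
proof -
  define D where "D = gap N (\<lambda>s. s)"
  \<comment> \<open>the primitive of \<open>((1 - c) + c w\<^sup>2) powr (- 5 / 2)\<close> in \<open>w = 2 s - 1\<close>, scaled by \<open>k\<^sup>2 / 2 = c (1 - c) / 2\<close>\<close>
  define F where "F = (\<lambda>s. c / 6 * ((2 * s - 1) / D s ^ 3) + c / (3 * (1 - c)) * ((2 * s - 1) / D s))"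
  have F: "(F has_vector_derivative (k / (D s)\<^sup>2)\<^sup>2 / D s) (at s within {0..1})" for s
  proof -
    define w where "w = 2 * s - 1"
    have D: "0 < D s" and cw: "c * w\<^sup>2 = (D s)\<^sup>2 - (1 - c)"
      using gap_pos[of s] gap_sq_centred[of s] by (simp_all add: D_def w_def)
    have dD: "(D has_real_derivative 2 * (c * w) / D s) (at s within {0..1})"
      unfolding D_def w_def by (rule gap_has_real_derivative_centred)
    have dw: "((\<lambda>s. 2 * s - 1) has_real_derivative 2) (at s within {0..1})"
      by (auto intro!: derivative_eq_intros)
    have d1: "((\<lambda>s. (2 * s - 1) / D s) has_real_derivative 2 * (1 - c) / D s ^ 3) (at s within {0..1})"
    proof (rule DERIV_cong[OF DERIV_divide[OF dw dD]])
      have "(2 * D s - w * (2 * (c * w) / D s)) = (2 * (D s)\<^sup>2 - 2 * (c * w\<^sup>2)) / D s"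
        using D by (simp add: field_simps power2_eq_square)
      then show "(2 * D s - (2 * s - 1) * (2 * (c * w) / D s)) / (D s * D s) = 2 * (1 - c) / D s ^ 3"
        unfolding w_def[symmetric] cw by (simp add: power3_eq_cube)
    qed (use D in simp)
    have d2: "((\<lambda>s. (2 * s - 1) / D s ^ 3) has_real_derivative
        (2 * (D s)\<^sup>2 - 6 * (c * w\<^sup>2)) / D s ^ 5) (at s within {0..1})"
    proof (rule DERIV_cong[OF DERIV_divide[OF dw DERIV_power[OF dD]]])
      show "(2 * D s ^ 3 - (2 * s - 1) * (of_nat 3 * (2 * (c * w) / D s * D s ^ (3 - Suc 0))))
          / (D s ^ 3 * D s ^ 3) = (2 * (D s)\<^sup>2 - 6 * (c * w\<^sup>2)) / D s ^ 5"
        unfolding w_def[symmetric] using D by (simp add: field_simps eval_nat_numeral)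
    qed (use D in simp)
    \<comment> \<open>With \<open>c * w\<^sup>2\<close> eliminated, the terms in
      \<open>(D s)\<^sup>2 / D s ^ 5\<close> of the two summands cancel; this fixes the coefficients
      in \<open>F\<close>.\<close>
    have "c / 6 * ((2 * (D s)\<^sup>2 - 6 * (c * w\<^sup>2)) / D s ^ 5) + c / (3 * (1 - c)) * (2 * (1 - c) / D s ^ 3)
        = (k / (D s)\<^sup>2)\<^sup>2 / D s"
    proof -
      have "c / (3 * (1 - c)) * (2 * (1 - c) / D s ^ 3) = 2 / 3 * c * (D s)\<^sup>2 / D s ^ 5"
        using c_bounds D by (simp add: field_simps eval_nat_numeral)
      moreover have "c / 6 * ((2 * (D s)\<^sup>2 - 6 * (c * w\<^sup>2)) / D s ^ 5)
          = (c * (1 - c) - 2 / 3 * c * (D s)\<^sup>2) / D s ^ 5"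
        unfolding cw using D by (simp add: field_simps)
      moreover have "(k / (D s)\<^sup>2)\<^sup>2 / D s = c * (1 - c) / D s ^ 5"
        using k_sq by (simp add: power_divide eval_nat_numeral)
      ultimately show ?thesis by (simp add: diff_divide_distrib)
    qed
    then show ?thesis
      unfolding F_def has_real_derivative_iff_has_vector_derivative[symmetric]
      by (intro DERIV_cong[OF DERIV_add[OF DERIV_cmult[OF d2] DERIV_cmult[OF d1]]])
  qed
  have "((\<lambda>s. (k / (D s)\<^sup>2)\<^sup>2 / D s) has_integral (F 1 - F 0)) {0..1}"
    by (rule fundamental_theorem_of_calculus) (use F in auto)
  moreover have "D 0 = 1" "D 1 = 1" by (simp_all add: D_def gap_def)
  then have "F 1 - F 0 = c / 3 + 2 / 3 * (c / (1 - c))"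
    by (simp add: F_def)
  moreover have "c / (1 - c) = real N - 1"
    using N by (simp add: c_def field_simps)
  ultimately show ?thesis by (simp add: D_def add_divide_distrib add.commute)
qed

lemma gap_at_endpoints: "gap N (\<lambda>s. s) 0 = 1" "gap N (\<lambda>s. s) 1 = 1"
  by (simp_all add: gap_def)

lemma lambda_has_real_derivative:
  "((\<lambda>s. k / gap N (\<lambda>s. s) s ^ 3) has_real_derivative
     - 6 * k * c * (2 * s - 1) / gap N (\<lambda>s. s) s ^ 5) (at s within S)"
proof (rule DERIV_cong[OF DERIV_divide[OF DERIV_const DERIV_power[OF gap_has_real_derivative_centred]]])
  show "(0 * gap N (\<lambda>s. s) s ^ 3 -
     k * (of_nat 3 * (2 * (c * (2 * s - 1)) / gap N (\<lambda>s. s) s * gap N (\<lambda>s. s) s ^ (3 - Suc 0)))) /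
    (gap N (\<lambda>s. s) s ^ 3 * gap N (\<lambda>s. s) s ^ 3) =
    - 6 * k * c * (2 * s - 1) / gap N (\<lambda>s. s) s ^ 5"
    using gap_pos[of s] by (simp add: field_simps eval_nat_numeral)
qed (use gap_nonzero in simp)

text \<open>The function is the corrector \<open>y\<close>, the derivative of
  \<open>k / D ^ 3\<close> divided by the gap \<open>D\<close>. Its own derivative enters the error
  only through a maximum, hence the unsimplified quotient.\<close>

lemma second_corrector_has_real_derivative:
  "((\<lambda>s. - 6 * k * c * (2 * s - 1) / gap N (\<lambda>s. s) s ^ 6) has_real_derivative
     (- 12 * k * c * gap N (\<lambda>s. s) s ^ 6 + 72 * k * c\<^sup>2 * (2 * s - 1)\<^sup>2 * gap N (\<lambda>s. s) s ^ 4)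
       / (gap N (\<lambda>s. s) s ^ 6 * gap N (\<lambda>s. s) s ^ 6)) (at s within S)"
proof -
  have "((\<lambda>s. - 6 * k * c * (2 * s - 1)) has_real_derivative - 12 * k * c) (at s within S)"
    by (auto intro!: derivative_eq_intros)
  note d = DERIV_divide[OF this DERIV_power[where n = 6, OF gap_has_real_derivative_centred]]
  show ?thesis
  proof (rule DERIV_cong[OF d])
    have "2 * (c * (2 * s - 1)) / gap N (\<lambda>s. s) s * gap N (\<lambda>s. s) s ^ (6 - Suc 0)
      = 2 * (c * (2 * s - 1)) * gap N (\<lambda>s. s) s ^ 4"
      using gap_pos[of s] by (simp add: eval_nat_numeral)
    then show "(- 12 * k * c * gap N (\<lambda>s. s) s ^ 6 - - 6 * k * c * (2 * s - 1) *
       (of_nat 6 * (2 * (c * (2 * s - 1)) / gap N (\<lambda>s. s) s * gap N (\<lambda>s. s) s ^ (6 - Suc 0))))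
      / (gap N (\<lambda>s. s) s ^ 6 * gap N (\<lambda>s. s) s ^ 6) =
      (- 12 * k * c * gap N (\<lambda>s. s) s ^ 6 + 72 * k * c\<^sup>2 * (2 * s - 1)\<^sup>2 * gap N (\<lambda>s. s) s ^ 4)
       / (gap N (\<lambda>s. s) s ^ 6 * gap N (\<lambda>s. s) s ^ 6)"
      by (simp only:) (simp add: power2_eq_square algebra_simps)
  qed (use gap_nonzero in simp)
qed

lemma continuous_on_gap: "continuous_on S (gap N (\<lambda>s. s))"
  using DERIV_continuous_on[OF gap_has_real_derivative] by blast

end

section \<open>The search subspace\<close>

lemma cinner_add_right: "cinner x (y + z) = cinner x y + cinner x z"
  by (simp add: cinner_def distrib_left sum.distrib)

lemma cinner_diff_right: "cinner x (y - z) = cinner x y - cinner x z"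
  by (simp add: cinner_def right_diff_distrib sum_subtractf)

lemma cinner_scaleR_right: "cinner x (a *\<^sub>R y) = of_real a * cinner x y"
  by (simp add: cinner_def scaleR_conv_of_real[where 'a = complex] sum_distrib_left mult_ac)

lemma cinner_scale_right: "cinner x (a *s y) = a * cinner x y"
  by (simp add: cinner_def sum_distrib_left mult_ac)

lemma cinner_sum_right: "cinner x (\<Sum>i\<in>A. f i) = (\<Sum>i\<in>A. cinner x (f i))"
  by (simp add: cinner_def sum_distrib_left) (rule sum.swap)

lemma cinner_commute: "cinner y x = cnj (cinner x y)"
  by (simp add: cinner_def mult.commute)

lemma cinner_add_left: "cinner (x + y) z = cinner x z + cinner y z"
  by (subst (1 2 3) cinner_commute) (simp add: cinner_add_right)

lemma cinner_diff_left: "cinner (x - y) z = cinner x z - cinner y z"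
  by (subst (1 2 3) cinner_commute) (simp add: cinner_diff_right)

lemma cinner_scaleR_left: "cinner (a *\<^sub>R x) y = of_real a * cinner x y"
  by (subst (1 2) cinner_commute) (simp add: cinner_scaleR_right)

lemma cinner_sum_left: "cinner (\<Sum>i\<in>A. f i) x = (\<Sum>i\<in>A. cinner (f i) x)"
  by (simp add: cinner_commute[of _ x] cinner_sum_right)

lemmas cinner_simps = cinner_add_left cinner_add_right cinner_diff_left cinner_diff_right
  cinner_scaleR_left cinner_scaleR_right cinner_scale_right

text \<open>Real linearity is what differentiation of \<open>cinner x (psi s)\<close> in the real
  variable \<open>s\<close> calls for.\<close>

lemma bounded_linear_cinner_right: "bounded_linear (cinner x)"
  by (intro linear_conv_bounded_linear[THEN iffD1] linearI)
    (simp_all add: cinner_add_right cinner_scaleR_right scaleR_conv_of_real[where 'a = complex])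

lemma search_hamiltonian_mult_vec:
  "search_hamiltonian E e m f s *v z = E *\<^sub>R ((1 - f s) *\<^sub>R (z - cinner (uniform_state e) z *s uniform_state e)
     + f s *\<^sub>R (z - cinner (e m) z *s e m))"
proof -
  have ketbra: "ketbra x y *v z = cinner y z *s x" for x y :: "complex ^ 'a"
    by (simp add: vec_eq_iff ketbra_def matrix_vector_mult_def cinner_def sum_distrib_left mult_ac)
  have scaleR: "(a *\<^sub>R A) *v z = a *\<^sub>R (A *v z)" for a :: real and A :: "complex ^ 'a ^ 'a"
    by (simp add: vec_eq_iff matrix_vector_mult_def scaleR_sum_right)
  show ?thesis
    by (simp add: search_hamiltonian_def scaleR ketbra matrix_vector_mult_add_rdistrib
        matrix_vector_mult_diff_rdistrib)
qed

section \<open>Orthonormal frame of the invariant subspace\<close>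

locale search_basis =
  fixes e :: "'n::finite \<Rightarrow> complex ^ 'n" and m :: 'n
  assumes orthonormal: "orthonormal_basis e"
    and card_ge_2: "2 \<le> CARD('n)"
begin

lemma marked_marked: "cinner (e m) (e m) = 1"
  using orthonormal by (simp add: orthonormal_basis_def)

lemma marked_uniform: "cinner (e m) (uniform_state e) = 1 / sqrt CARD('n)"
  and uniform_marked: "cinner (uniform_state e) (e m) = 1 / sqrt CARD('n)"
  using orthonormal
  by (simp_all add: uniform_state_def cinner_scaleR_right cinner_scaleR_left cinner_sum_left cinner_sum_right
      orthonormal_basis_def)

lemma uniform_uniform: "cinner (uniform_state e) (uniform_state e) = 1"
  using orthonormal
  by (simp add: uniform_state_def cinner_scaleR_right cinner_scaleR_left cinner_sum_left cinner_sum_right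
      orthonormal_basis_def flip: of_real_mult)

lemma uniform_state_decomposition:
  "uniform_state e = (1 / sqrt CARD('n)) *\<^sub>R e m
     + sqrt ((real CARD('n) - 1) / CARD('n)) *\<^sub>R m_perp e m"
proof -
  have "sqrt ((real CARD('n) - 1) / CARD('n)) * sqrt (CARD('n) / (real CARD('n) - 1)) = 1"
    using card_ge_2 by (simp flip: real_sqrt_mult)
  then show ?thesis by (simp add: m_perp_def)
qed

lemma marked_perp: "cinner (e m) (m_perp e m) = 0"
  by (simp add: m_perp_def cinner_simps marked_marked marked_uniform)

lemma perp_marked: "cinner (m_perp e m) (e m) = 0"
  using cinner_commute[of "m_perp e m" "e m"] by (simp add: marked_perp)

text \<open>The overlap of the uniform state with \<open>m_perp\<close> is computed twice, once by
  decomposing the uniform state and once by unfolding \<open>m_perp\<close>; comparison gives the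
  norm.\<close>

lemma perp_perp: "cinner (m_perp e m) (m_perp e m) = 1"
proof -
  have "cinner (uniform_state e) (m_perp e m) = sqrt ((real CARD('n) - 1) / CARD('n)) * cinner (m_perp e m) (m_perp e m)"
    by (subst uniform_state_decomposition) (simp add: cinner_simps marked_perp)
  moreover have "cinner (uniform_state e) (m_perp e m) = sqrt (real CARD('n) / (real CARD('n) - 1)) * (1 - 1 / CARD('n))"
    by (simp add: m_perp_def cinner_simps uniform_uniform uniform_marked flip: of_real_mult of_real_diff)
      (simp add: divide_inverse)
  moreover have "sqrt (real CARD('n) / (real CARD('n) - 1)) * (1 - 1 / CARD('n)) = sqrt ((real CARD('n) - 1) / CARD('n))"
    using card_ge_2 by (simp add: real_sqrt_divide field_simps)
  ultimately show ?thesis using card_ge_2 by simp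
qed

end

lemma continuous_on_abs_bounded:
  fixes f :: "real \<Rightarrow> real"
  assumes "continuous_on {a..b} f"
  shows "\<exists>B. \<forall>s\<in>{a..b}. \<bar>f s\<bar> \<le> B"
proof -
  have "bounded (f ` {a..b})"
    by (intro compact_imp_bounded compact_continuous_image assms compact_Icc)
  then show ?thesis by (simp add: bounded_iff)
qed

section \<open>Error, validity time and validity error\<close>

locale linear_adiabatic_search = linear_interpolation N c k + search_basis e m
  for N :: nat and c k :: real and e :: "'n::finite \<Rightarrow> complex ^ 'n" and m :: 'n +
  assumes card: "CARD('n) = N"
begin

abbreviation (input) D :: "real \<Rightarrow> real" where "D \<equiv> gap N (\<lambda>s. s)"
abbreviation (input) p :: "real \<Rightarrow> real" where "p s \<equiv> sin (mixing_angle N (\<lambda>s. s) s / 2)"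
abbreviation (input) q :: "real \<Rightarrow> real" where "q s \<equiv> cos (mixing_angle N (\<lambda>s. s) s / 2)"

section \<open>Coupling and the validity quantities\<close>

lemma p_has_real_derivative: "s \<in> {0..1} \<Longrightarrow> (p has_real_derivative k / (D s)\<^sup>2 * q s) (at s within {0..1})"
  and q_has_real_derivative: "s \<in> {0..1} \<Longrightarrow> (q has_real_derivative - (k / (D s)\<^sup>2) * p s) (at s within {0..1})"
proof -
  assume "s \<in> {0..1}"
  note half = DERIV_cdivide[OF mixing_angle_has_real_derivative[OF this], of 2]
  show "(p has_real_derivative k / (D s)\<^sup>2 * q s) (at s within {0..1})"
    by (rule DERIV_cong[OF DERIV_chain2[OF DERIV_sin half]]) simp
  show "(q has_real_derivative - (k / (D s)\<^sup>2) * p s) (at s within {0..1})"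
    by (rule DERIV_cong[OF DERIV_chain2[OF DERIV_cos half]]) simp
qed

lemma phi0_has_vector_derivative:
  assumes "s \<in> {0..1}"
  shows "(phi0 e m (\<lambda>s. s) has_vector_derivative (k / (D s)\<^sup>2) *\<^sub>R phi1 e m (\<lambda>s. s) s) (at s within {0..1})"
proof -
  have "((\<lambda>s. p s *\<^sub>R e m + q s *\<^sub>R m_perp e m) has_vector_derivative
      (p s *\<^sub>R 0 + (k / (D s)\<^sup>2 * q s) *\<^sub>R e m)
      + (q s *\<^sub>R 0 + (- (k / (D s)\<^sup>2) * p s) *\<^sub>R m_perp e m)) (at s within {0..1})"
    by (intro has_vector_derivative_add has_vector_derivative_scaleR has_vector_derivative_const
        p_has_real_derivative q_has_real_derivative assms)
  then show ?thesis
    by (simp add: phi0_def[abs_def] phi1_def card scaleR_diff_right)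
qed

text \<open>The derivative of \<open>phi0\<close> points along \<open>phi1\<close>, and
  \<open>phi1\<close> is a unit vector.\<close>

lemma coupling_eq:
  assumes "s \<in> {0..1}"
  shows "coupling e m (\<lambda>s. s) s = of_real (k / (D s)\<^sup>2)"
proof -
  define P Q where "P = p s" and "Q = q s"
  have "phi1 e m (\<lambda>s. s) s = Q *\<^sub>R e m - P *\<^sub>R m_perp e m"
    by (simp add: phi1_def card P_def Q_def)
  then have "cinner (phi1 e m (\<lambda>s. s) s) (phi1 e m (\<lambda>s. s) s) = of_real (Q * Q + P * P)"
    by (simp add: cinner_simps marked_marked marked_perp perp_marked perp_perp)
  also have "Q * Q + P * P = 1" by (simp add: P_def Q_def flip: power2_eq_square)
  finally have "cinner (phi1 e m (\<lambda>s. s) s) (phi1 e m (\<lambda>s. s) s) = 1" by simp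
  then show ?thesis
    unfolding coupling_def
      vector_derivative_within_closed_interval[OF zero_less_one assms phi0_has_vector_derivative[OF assms]]
    by (simp add: cinner_scaleR_right)
qed

lemma lambda10_eq: "s \<in> {0..1} \<Longrightarrow> lambda10 e m (\<lambda>s. s) s = of_real (k / D s ^ 3)"
  by (simp add: lambda10_def coupling_eq card power2_eq_square power3_eq_cube)

lemma J0_at_1_eq: "J0_at_1 e m (\<lambda>s. s) = (2 * (real N - 1) + c) / 3"
proof -
  have "J0_at_1 e m (\<lambda>s. s) = integral {0..1} (\<lambda>s. (k / (D s)\<^sup>2)\<^sup>2 / D s)"
    unfolding J0_at_1_def card
    by (rule integral_cong) (simp add: coupling_eq norm_divide norm_power power_divide)
  then show ?thesis using coupling_integral by (simp add: integral_unique)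
qed

lemma lambda10_logarithmic_derivative:
  "vector_derivative (lambda10 e m (\<lambda>s. s)) (at 1 within {0..1}) / lambda10 e m (\<lambda>s. s) 1 = of_real (- 6 * c)"
proof -
  have "((\<lambda>s. k / D s ^ 3) has_real_derivative - 6 * k * c) (at 1 within {0..1})"
    using lambda_has_real_derivative[of 1 "{0..1}"] by (simp add: gap_at_endpoints)
  then have "((\<lambda>s. complex_of_real (k / D s ^ 3)) has_vector_derivative of_real (- 6 * k * c)) (at 1 within {0..1})"
    by (rule has_vector_derivative_of_real)
  \<comment> \<open>The closed form of \<open>lambda10\<close> is available on \<open>[0,1]\<close>,
    which determines the derivative within that interval.\<close>
  then have "(lambda10 e m (\<lambda>s. s) has_vector_derivative of_real (- 6 * k * c)) (at 1 within {0..1})"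
    by (rule has_vector_derivative_transform[rotated 2]) (simp_all add: lambda10_eq)
  then have "vector_derivative (lambda10 e m (\<lambda>s. s)) (at 1 within {0..1}) = of_real (- 6 * k * c)"
    by (intro vector_derivative_within_closed_interval) auto
  then show ?thesis using k_pos by (simp add: lambda10_eq gap_at_endpoints)
qed

lemma validity_time_eq:
  "validity_time hbar E C e m (\<lambda>s. s)
    = hbar / E * (C / 3) * \<bar>2 * (real N - 1) - 17 * ((real N - 1) / real N)\<bar>"
proof -
  \<comment> \<open>The 17 arises as \<open>18 - 1\<close>: the logarithmic derivative contributes
    \<open>- 18 * c / 3\<close> and the integral \<open>c / 3\<close>.\<close>
  have "(2 * (real N - 1) + c) / 3 + - 6 * c = (2 * (real N - 1) - 17 * c) / 3" by simp
  then have "cmod (complex_of_real (J0_at_1 e m (\<lambda>s. s)) + of_real (- 6 * c)) = \<bar>2 * (real N - 1) - 17 * c\<bar> / 3"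
    unfolding J0_at_1_eq of_real_add[symmetric] norm_of_real by (simp only: abs_divide abs_numeral)
  then show ?thesis
    unfolding validity_time_def lambda10_logarithmic_derivative c_def[symmetric] by (simp only:)
qed

text \<open>Factoring \<open>(N - 1) / N\<close> out of the absolute value leaves
  \<open>2 * N - 17\<close>; one square root of \<open>N - 1\<close> then cancels against
  \<open>lambda10\<close> at \<open>1\<close>, which is \<open>k\<close>.\<close>

lemma validity_error_eq:
  assumes "0 < hbar" "0 < E" "0 < C"
  shows "validity_error hbar E C e m (\<lambda>s. s) = 6 / (C * \<bar>(2 * real N - 17) * sqrt (real N - 1)\<bar>)"
proof -
  have N1: "0 < real N - 1" using N by simp
  have "2 * (real N - 1) - 17 * ((real N - 1) / real N) = (real N - 1) / real N * (2 * real N - 17)"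
    using N by (simp add: field_simps)
  then have abs: "\<bar>2 * (real N - 1) - 17 * ((real N - 1) / real N)\<bar> = (real N - 1) / real N * \<bar>2 * real N - 17\<bar>"
    using N1 by (simp add: abs_mult)
  have "cmod (lambda10 e m (\<lambda>s. s) 1) = sqrt (real N - 1) / real N"
    using k_pos unfolding k_def[symmetric] by (simp add: lambda10_eq gap_at_endpoints)
  then have "validity_error hbar E C e m (\<lambda>s. s)
      = 6 * (sqrt (real N - 1) / (C * ((real N - 1) * \<bar>2 * real N - 17\<bar>)))"
    unfolding validity_error_def validity_time_eq abs
    using assms N by simp
  also have "(C * ((real N - 1) * \<bar>2 * real N - 17\<bar>))
      = sqrt (real N - 1) * (C * (\<bar>2 * real N - 17\<bar> * sqrt (real N - 1)))"
    using N1 by (simp add: mult_ac)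
  finally show ?thesis using N1 by (simp add: abs_mult)
qed

section \<open>The evolution in the instantaneous eigenbasis\<close>

definition \<alpha> :: "(real \<Rightarrow> complex ^ 'n) \<Rightarrow> real \<Rightarrow> complex" where
  "\<alpha> psi s = of_real (p s) * cinner (e m) (psi s) + of_real (q s) * cinner (m_perp e m) (psi s)"

text \<open>With \<open>\<alpha>\<close>, the components of \<open>psi s\<close> along
  \<open>phi0\<close> and \<open>phi1\<close>, spelled out in the fixed frame so that only real
  half-angle factors and fixed inner products need differentiating.\<close>

definition \<beta> :: "(real \<Rightarrow> complex ^ 'n) \<Rightarrow> real \<Rightarrow> complex" where
  "\<beta> psi s = of_real (q s) * cinner (e m) (psi s) - of_real (p s) * cinner (m_perp e m) (psi s)"

lemma cinner_uniform: "cinner (uniform_state e) z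
    = of_real (sqrt (1 - c)) * cinner (e m) z + of_real (sqrt c) * cinner (m_perp e m) z"
proof -
  have "1 / sqrt (real N) = sqrt (1 - c)" "(real N - 1) / real N = c"
    using N by (simp_all add: c_def field_simps real_sqrt_divide)
  then show ?thesis
    by (subst uniform_state_decomposition) (simp only: card cinner_simps)
qed

lemma marked_uniform': "cinner (e m) (uniform_state e) = of_real (sqrt (1 - c))"
  and perp_uniform': "cinner (m_perp e m) (uniform_state e) = of_real (sqrt c)"
  using cinner_uniform[of "e m"] cinner_uniform[of "m_perp e m"]
    cinner_commute[of "e m" "uniform_state e"] cinner_commute[of "m_perp e m" "uniform_state e"]
  by (simp_all add: marked_marked marked_perp perp_marked perp_perp)

lemma sqrt_c: "sqrt (1 - c) * sqrt (1 - c) = 1 - c" "sqrt c * sqrt c = c" "sqrt (1 - c) * sqrt c = k"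
proof -
  show "sqrt (1 - c) * sqrt (1 - c) = 1 - c" "sqrt c * sqrt c = c" using c_bounds by simp_all
  have "sqrt (1 - c) * sqrt c = sqrt (k\<^sup>2)" unfolding k_sq real_sqrt_mult by simp
  then show "sqrt (1 - c) * sqrt c = k" using k_pos by simp
qed

text \<open>Pairing the equation with the two frame vectors gives a closed system, because
  \<open>cinner_uniform\<close> expresses the overlap of any vector with the uniform state through
  these two components.\<close>

lemma evolution_coefficients:
  assumes ev: "search_evolution hbar E e m (\<lambda>s. s) T psi" and pos: "0 < hbar" "0 < T"
    and s: "s \<in> {0..1}"
  defines "a \<equiv> cinner (e m) (psi s)" and "b \<equiv> cinner (m_perp e m) (psi s)" and "\<tau> \<equiv> E * T / hbar"
  shows "((\<lambda>s. cinner (e m) (psi s)) has_vector_derivative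
      - \<i> * of_real \<tau> * (of_real (c * (1 - s)) * a - of_real (k * (1 - s)) * b)) (at s within {0..1})"
    and "((\<lambda>s. cinner (m_perp e m) (psi s)) has_vector_derivative
      - \<i> * of_real \<tau> * (of_real (1 - c * (1 - s)) * b - of_real (k * (1 - s)) * a)) (at s within {0..1})"
proof -
  obtain d where d: "(psi has_vector_derivative d) (at s within {0..1})"
    and eq: "(\<i> * of_real hbar / of_real T) *s d = search_hamiltonian E e m (\<lambda>s. s) s *v psi s"
    using ev s unfolding search_evolution_def by blast
  have inner: "cinner x d = - \<i> * of_real (T / hbar) * cinner x (search_hamiltonian E e m (\<lambda>s. s) s *v psi s)" for x
    unfolding eq[symmetric] cinner_scale_right using pos by simp
  have "cinner (e m) d = - \<i> * of_real \<tau> *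
      (of_real (1 - s) * (a - (of_real (sqrt (1 - c)) * a + of_real (sqrt c) * b) * of_real (sqrt (1 - c))))"
    by (simp add: inner search_hamiltonian_mult_vec cinner_simps cinner_uniform marked_uniform'
        marked_marked a_def b_def \<tau>_def) (simp add: algebra_simps)
  also have "a - (of_real (sqrt (1 - c)) * a + of_real (sqrt c) * b) * of_real (sqrt (1 - c))
      = a - of_real (sqrt (1 - c) * sqrt (1 - c)) * a - of_real (sqrt (1 - c) * sqrt c) * b"
    by (simp only: of_real_mult) (simp add: algebra_simps)
  also have "\<dots> = of_real c * a - of_real k * b"
    unfolding sqrt_c by (simp add: algebra_simps)
  finally have "cinner (e m) d
      = - \<i> * of_real \<tau> * (of_real (c * (1 - s)) * a - of_real (k * (1 - s)) * b)"
    by (simp add: algebra_simps)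
  then show "((\<lambda>s. cinner (e m) (psi s)) has_vector_derivative
      - \<i> * of_real \<tau> * (of_real (c * (1 - s)) * a - of_real (k * (1 - s)) * b)) (at s within {0..1})"
    using bounded_linear.has_vector_derivative[OF bounded_linear_cinner_right d] by metis
  have "cinner (m_perp e m) d = - \<i> * of_real \<tau> *
      (of_real (1 - s) * (b - (of_real (sqrt (1 - c)) * a + of_real (sqrt c) * b) * of_real (sqrt c))
        + of_real s * b)"
    by (simp add: inner search_hamiltonian_mult_vec cinner_simps cinner_uniform perp_uniform'
        perp_marked a_def b_def \<tau>_def) (simp add: algebra_simps)
  also have "b - (of_real (sqrt (1 - c)) * a + of_real (sqrt c) * b) * of_real (sqrt c)
      = b - of_real (sqrt c * sqrt c) * b - of_real (sqrt (1 - c) * sqrt c) * a"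
    by (simp only: of_real_mult) (simp add: algebra_simps)
  also have "\<dots> = b - of_real c * b - of_real k * a"
    unfolding sqrt_c by (simp add: algebra_simps)
  finally have "cinner (m_perp e m) d
      = - \<i> * of_real \<tau> * (of_real (1 - c * (1 - s)) * b - of_real (k * (1 - s)) * a)"
    by (simp add: algebra_simps)
  then show "((\<lambda>s. cinner (m_perp e m) (psi s)) has_vector_derivative
      - \<i> * of_real \<tau> * (of_real (1 - c * (1 - s)) * b - of_real (k * (1 - s)) * a)) (at s within {0..1})"
    using bounded_linear.has_vector_derivative[OF bounded_linear_cinner_right d] by metis
qed

text \<open>Rotation of the basis produces the real coupling \<open>k / (D s)\<^sup>2\<close>; the
  Hamiltonian contributes only its eigenvalues \<open>(1 - D s) / 2\<close> and
  \<open>(1 + D s) / 2\<close>.\<close>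

lemma eigenbasis_coefficients:
  assumes ev: "search_evolution hbar E e m (\<lambda>s. s) T psi" and pos: "0 < hbar" "0 < T"
    and s: "s \<in> {0..1}"
  defines "\<tau> \<equiv> E * T / hbar"
  shows "(\<alpha> psi has_vector_derivative
      (of_real (k / (D s)\<^sup>2) * \<beta> psi s - \<i> * of_real (\<tau> * ((1 - D s) / 2)) * \<alpha> psi s)) (at s within {0..1})"
    and "(\<beta> psi has_vector_derivative
      (- of_real (k / (D s)\<^sup>2) * \<alpha> psi s - \<i> * of_real (\<tau> * ((1 + D s) / 2)) * \<beta> psi s)) (at s within {0..1})"
proof -
  define a b where "a = cinner (e m) (psi s)" and "b = cinner (m_perp e m) (psi s)"
  define A' where "A' = - \<i> * of_real \<tau> * (of_real (c * (1 - s)) * a - of_real (k * (1 - s)) * b)"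
  define B' where "B' = - \<i> * of_real \<tau> * (of_real (1 - c * (1 - s)) * b - of_real (k * (1 - s)) * a)"
  note ab = evolution_coefficients[OF ev pos s, folded a_def b_def \<tau>_def, folded A'_def B'_def]
  note p = has_vector_derivative_of_real[OF p_has_real_derivative[OF s]]
  note q = has_vector_derivative_of_real[OF q_has_real_derivative[OF s]]
  have s1: "s \<le> 1" using s by simp
  define L U where "L = (1 - D s) / 2" and "U = (1 + D s) / 2"
  have lower: "of_real (p s) * A' + of_real (q s) * B'
      = - \<i> * of_real \<tau> * (of_real (L * p s) * a + of_real (L * q s) * b)"
    unfolding L_def eigenvector_relations(1,2)[OF s1, symmetric] by (simp add: A'_def B'_def algebra_simps)
  have upper: "of_real (q s) * A' - of_real (p s) * B'
      = - \<i> * of_real \<tau> * (of_real (U * q s) * a - of_real (U * p s) * b)"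
    unfolding U_def eigenvector_relations(3,4)[OF s1, symmetric] by (simp add: A'_def B'_def algebra_simps)
  have "(\<alpha> psi has_vector_derivative
      (of_real (p s) * A' + of_real (k / (D s)\<^sup>2 * q s) * a
       + (of_real (q s) * B' + of_real (- (k / (D s)\<^sup>2) * p s) * b))) (at s within {0..1})"
    unfolding \<alpha>_def[abs_def] a_def b_def
    by (intro has_vector_derivative_add has_vector_derivative_mult p q ab)
  then show "(\<alpha> psi has_vector_derivative
      (of_real (k / (D s)\<^sup>2) * \<beta> psi s - \<i> * of_real (\<tau> * ((1 - D s) / 2)) * \<alpha> psi s)) (at s within {0..1})"
  proof (rule has_vector_derivative_eq_rhs)
    have "of_real (p s) * A' + of_real (k / (D s)\<^sup>2 * q s) * a
       + (of_real (q s) * B' + of_real (- (k / (D s)\<^sup>2) * p s) * b)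
       = (of_real (p s) * A' + of_real (q s) * B') + of_real (k / (D s)\<^sup>2) * \<beta> psi s"
      by (simp add: \<beta>_def a_def b_def algebra_simps)
    also have "\<dots> = of_real (k / (D s)\<^sup>2) * \<beta> psi s - \<i> * of_real (\<tau> * L) * \<alpha> psi s"
      unfolding lower by (simp add: \<alpha>_def a_def b_def algebra_simps)
    finally show "of_real (p s) * A' + of_real (k / (D s)\<^sup>2 * q s) * a
       + (of_real (q s) * B' + of_real (- (k / (D s)\<^sup>2) * p s) * b)
       = of_real (k / (D s)\<^sup>2) * \<beta> psi s - \<i> * of_real (\<tau> * ((1 - D s) / 2)) * \<alpha> psi s"
      unfolding L_def .
  qed
  have "(\<beta> psi has_vector_derivative
      (of_real (q s) * A' + of_real (- (k / (D s)\<^sup>2) * p s) * a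
       - (of_real (p s) * B' + of_real (k / (D s)\<^sup>2 * q s) * b))) (at s within {0..1})"
    unfolding \<beta>_def[abs_def] a_def b_def
    by (intro has_vector_derivative_diff has_vector_derivative_mult p q ab)
  then show "(\<beta> psi has_vector_derivative
      (- of_real (k / (D s)\<^sup>2) * \<alpha> psi s - \<i> * of_real (\<tau> * ((1 + D s) / 2)) * \<beta> psi s)) (at s within {0..1})"
  proof (rule has_vector_derivative_eq_rhs)
    have "of_real (q s) * A' + of_real (- (k / (D s)\<^sup>2) * p s) * a
       - (of_real (p s) * B' + of_real (k / (D s)\<^sup>2 * q s) * b)
       = (of_real (q s) * A' - of_real (p s) * B') - of_real (k / (D s)\<^sup>2) * \<alpha> psi s"
      by (simp add: \<alpha>_def a_def b_def algebra_simps)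
    also have "\<dots> = - of_real (k / (D s)\<^sup>2) * \<alpha> psi s - \<i> * of_real (\<tau> * U) * \<beta> psi s"
      unfolding upper by (simp add: \<beta>_def a_def b_def algebra_simps)
    finally show "of_real (q s) * A' + of_real (- (k / (D s)\<^sup>2) * p s) * a
       - (of_real (p s) * B' + of_real (k / (D s)\<^sup>2 * q s) * b)
       = - of_real (k / (D s)\<^sup>2) * \<alpha> psi s - \<i> * of_real (\<tau> * ((1 + D s) / 2)) * \<beta> psi s"
      unfolding U_def .
  qed
qed

text \<open>The half-angle relations at \<open>0\<close> give the squares and the product of
  \<open>p 0\<close> and \<open>q 0\<close>, so both amplitudes are evaluated through their squares.
  This leaves the sign of \<open>\<alpha>\<close> open, and the modulus absorbs it.\<close>

lemma initial_coefficients: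
  assumes "search_evolution hbar E e m (\<lambda>s. s) T psi"
  shows "cmod (\<alpha> psi 0) = 1" "\<beta> psi 0 = 0"
proof -
  define g d where "g = sqrt (1 - c)" and "d = sqrt c"
  have psi0: "psi 0 = uniform_state e" using assms by (simp add: search_evolution_def)
  have gd: "g\<^sup>2 = 1 - c" "d\<^sup>2 = c" "g * d = k"
    using sqrt_c by (simp_all add: g_def d_def power2_eq_square)
  have "(p 0)\<^sup>2 + (q 0)\<^sup>2 = 1" "2 * c = 1 + ((q 0)\<^sup>2 - (p 0)\<^sup>2)" "k = p 0 * q 0"
    using half_angle_relations[of 0] by (simp_all add: gap_at_endpoints del: sin_cos_squared_add sin_cos_squared_add2)
  then have pq: "(p 0)\<^sup>2 = 1 - c" "(q 0)\<^sup>2 = c" "p 0 * q 0 = k" by linarith+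
  have "(p 0 * g + q 0 * d)\<^sup>2 = (p 0)\<^sup>2 * g\<^sup>2 + 2 * (p 0 * q 0) * (g * d) + (q 0)\<^sup>2 * d\<^sup>2"
    by (simp add: power2_eq_square algebra_simps)
  also have "\<dots> = (1 - c) * (1 - c) + 2 * (c * (1 - c)) + c * c"
    unfolding pq gd k_sq[symmetric] by (simp add: power2_eq_square)
  also have "\<dots> = 1" by (simp add: algebra_simps)
  finally have "\<bar>p 0 * g + q 0 * d\<bar> = 1" by (simp add: power2_eq_1_iff) argo
  moreover have "\<alpha> psi 0 = of_real (p 0 * g + q 0 * d)"
    by (simp add: \<alpha>_def psi0 marked_uniform' perp_uniform' g_def d_def)
  ultimately show "cmod (\<alpha> psi 0) = 1" by (simp only: norm_of_real)
  have "(q 0 * g - p 0 * d)\<^sup>2 = (q 0)\<^sup>2 * g\<^sup>2 - 2 * (p 0 * q 0) * (g * d) + (p 0)\<^sup>2 * d\<^sup>2"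
    by (simp add: power2_eq_square algebra_simps)
  also have "\<dots> = c * (1 - c) - 2 * (c * (1 - c)) + (1 - c) * c"
    unfolding pq gd k_sq[symmetric] by (simp add: power2_eq_square)
  also have "\<dots> = 0" by (simp add: algebra_simps)
  finally have "q 0 * g - p 0 * d = 0" by simp
  moreover have "\<beta> psi 0 = of_real (q 0 * g - p 0 * d)"
    by (simp add: \<beta>_def psi0 marked_uniform' perp_uniform' g_def d_def)
  ultimately show "\<beta> psi 0 = 0" by (simp only: of_real_0)
qed

text \<open>\<open>K\<close> is chosen before \<open>hbar\<close>, \<open>E\<close>,
  \<open>T\<close> and \<open>psi\<close>, which influence the bound only through
  \<open>E * T / hbar\<close>.\<close>

lemma search_error_bound:
  obtains K where "\<And>hbar E T psi. 0 < hbar \<Longrightarrow> 0 < E \<Longrightarrow> 0 < T \<Longrightarrow>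
    search_evolution hbar E e m (\<lambda>s. s) T psi \<Longrightarrow>
    search_error e m psi \<le> 2 * k / (E * T / hbar) + K / (E * T / hbar)\<^sup>2"
proof -
  define \<eta>' y y' where "\<eta>' = (\<lambda>s. - 6 * k * c * (2 * s - 1) / D s ^ 5)"
    and "y = (\<lambda>s. - 6 * k * c * (2 * s - 1) / D s ^ 6)"
    and "y' = (\<lambda>s. (- 12 * k * c * D s ^ 6 + 72 * k * c\<^sup>2 * (2 * s - 1)\<^sup>2 * D s ^ 4) / (D s ^ 6 * D s ^ 6))"
  \<comment> \<open>Summing the five absolute values yields a single continuous function whose bound
    serves all of them.\<close>
  have "continuous_on {0..1} (\<lambda>s. \<bar>k / (D s)\<^sup>2\<bar> + \<bar>k / D s ^ 3\<bar> + \<bar>\<eta>' s\<bar> + \<bar>y s\<bar> + \<bar>y' s\<bar>)"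
    unfolding \<eta>'_def y_def y'_def
    by (intro continuous_intros continuous_on_gap) (auto simp: gap_nonzero)
  then obtain B where B: "\<forall>s\<in>{0..1}.
      \<bar>\<bar>k / (D s)\<^sup>2\<bar> + \<bar>k / D s ^ 3\<bar> + \<bar>\<eta>' s\<bar> + \<bar>y s\<bar> + \<bar>y' s\<bar>\<bar> \<le> B"
    using continuous_on_abs_bounded by blast
  define M where "M = 3 * B + B\<^sup>2"
  show ?thesis
  proof (rule that)
    fix hbar E T :: real and psi
    assume pos: "0 < hbar" "0 < E" "0 < T" and ev: "search_evolution hbar E e m (\<lambda>s. s) T psi"
    define \<tau> where "\<tau> = E * T / hbar"
    have \<tau>: "0 < \<tau>" using pos by (simp add: \<tau>_def)
    note ode = eigenbasis_coefficients[OF ev pos(1,3), folded \<tau>_def]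
    note init = initial_coefficients[OF ev]
    have D_pos: "0 < D s" for s by (rule gap_pos)
    have rel: "k / (D s)\<^sup>2 = ((1 + D s) / 2 - (1 - D s) / 2) * (k / D s ^ 3)"
      "\<eta>' s = ((1 + D s) / 2 - (1 - D s) / 2) * y s" for s
      using D_pos[of s] by (simp_all add: \<eta>'_def y_def field_simps eval_nat_numeral)
    have bnd: "\<bar>k / (D s)\<^sup>2\<bar> \<le> B \<and> \<bar>k / D s ^ 3\<bar> \<le> B \<and> \<bar>\<eta>' s\<bar> \<le> B \<and> \<bar>y s\<bar> \<le> B \<and> \<bar>y' s\<bar> \<le> B"
      if "s \<in> {0..1}" for s
      using bspec[OF B that] by linarith
    have cont: "continuous_on {0..1} (\<lambda>s. (1 + D s) / 2)"
      by (intro continuous_intros continuous_on_gap) simp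
    have d\<eta>: "((\<lambda>s. k / D s ^ 3) has_real_derivative \<eta>' s) (at s within {0..1})" for s
      unfolding \<eta>'_def by (rule lambda_has_real_derivative)
    have dy: "(y has_real_derivative y' s) (at s within {0..1})" for s
      unfolding y_def y'_def by (rule second_corrector_has_real_derivative)
    note bound = two_level_adiabatic_bound[where \<alpha> = "\<alpha> psi" and \<beta> = "\<beta> psi"
        and \<kappa> = "\<lambda>s. k / (D s)\<^sup>2" and \<eta> = "\<lambda>s. k / D s ^ 3" and \<eta>' = \<eta>' and y = y and y' = y'
        and \<mu>\<^sub>0 = "\<lambda>s. (1 - D s) / 2" and \<mu>\<^sub>1 = "\<lambda>s. (1 + D s) / 2" and \<tau> = \<tau> and B = B,
        OF ode init d\<eta> dy rel cont bnd \<tau>]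
    \<comment> \<open>The corrector \<open>k / D ^ 3\<close> equals \<open>k\<close> at both
      endpoints, whence \<open>2 * k\<close>.\<close>
    have lead: "cmod (\<beta> psi 1) \<le> 2 * k / \<tau> + (M + B\<^sup>2 * M) / \<tau>\<^sup>2"
      using bound(1) k_pos by (simp add: gap_at_endpoints M_def)
    have "cmod (\<beta> psi 1) \<le> M / \<tau>" using bound(2) by (simp add: M_def)
    then have square: "(cmod (\<beta> psi 1))\<^sup>2 \<le> M\<^sup>2 / \<tau>\<^sup>2"
      using power_mono[of "cmod (\<beta> psi 1)" "M / \<tau>" 2] by (simp add: power_divide)
    \<comment> \<open>At \<open>s = 1\<close> the lower eigenvector is the marked state, so
      \<open>\<alpha>\<close> is the overlap whose \<open>arccos\<close> is the search
      error.\<close>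
    have "mixing_angle N (\<lambda>s. s) 1 = pi" by (simp add: mixing_angle_def gap_at_endpoints)
    then have "\<alpha> psi 1 = cinner (e m) (psi 1)" by (simp add: \<alpha>_def)
    moreover have "(cmod (\<alpha> psi 1))\<^sup>2 + (cmod (\<beta> psi 1))\<^sup>2 = 1"
      using sum_cmod_squares_constant[OF ode, of 1] init by simp
    ultimately have "search_error e m psi \<le> cmod (\<beta> psi 1) + 8 * (cmod (\<beta> psi 1))\<^sup>2"
      unfolding search_error_def by (intro arccos_le_of_sum_squares) simp_all
    also have "\<dots> \<le> 2 * k / \<tau> + (M + B\<^sup>2 * M + 8 * M\<^sup>2) / \<tau>\<^sup>2"
      using lead square by (simp add: add_divide_distrib)
    finally show "search_error e m psi \<le> 2 * k / (E * T / hbar) + (M + B\<^sup>2 * M + 8 * M\<^sup>2) / (E * T / hbar)\<^sup>2"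
      by (simp only: \<tau>_def)
  qed
qed

end

theorem mainTheorem6:
  fixes hbar E :: real
    and e :: "'n::finite \<Rightarrow> complex ^ 'n"
    and m :: 'n
    and N :: nat
  assumes "hbar > 0" and "E > 0"
    and "N = CARD('n)" and "N \<ge> 2"
    and "orthonormal_basis e"
  shows "(\<forall>Psi :: real \<Rightarrow> real \<Rightarrow> complex ^ 'n.
            (\<forall>T>0. search_evolution hbar E e m (\<lambda>s. s) T (\<lambda>s. Psi s T)) \<longrightarrow>
            (\<exists>R \<in> O[at_top](\<lambda>T::real. 1 / T\<^sup>2). \<forall>T>0.
               search_error e m (\<lambda>s. Psi s T)
                 \<le> hbar / (E * T) * (2 * sqrt (real N - 1) / real N) + R T))
       \<and> (\<forall>C::real. C > 0 \<longrightarrow>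
            validity_time hbar E C e m (\<lambda>s. s)
              = hbar / E * (C / 3) * \<bar>2 * (real N - 1) - 17 * ((real N - 1) / real N)\<bar>
          \<and> validity_error hbar E C e m (\<lambda>s. s)
              = 6 / (C * \<bar>(2 * real N - 17) * sqrt (real N - 1)\<bar>))"
proof (intro conjI allI impI)
  interpret linear_adiabatic_search N "(real N - 1) / real N" "sqrt (real N - 1) / real N" e m
    by unfold_locales (use assms in auto)
  fix C :: real
  assume "C > 0"
  show "validity_time hbar E C e m (\<lambda>s. s)
      = hbar / E * (C / 3) * \<bar>2 * (real N - 1) - 17 * ((real N - 1) / real N)\<bar>"
    by (rule validity_time_eq)
  show "validity_error hbar E C e m (\<lambda>s. s) = 6 / (C * \<bar>(2 * real N - 17) * sqrt (real N - 1)\<bar>)"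
    by (rule validity_error_eq) fact+
next
  interpret linear_adiabatic_search N "(real N - 1) / real N" "sqrt (real N - 1) / real N" e m
    by unfold_locales (use assms in auto)
  obtain K where K: "\<And>hbar E T psi. 0 < hbar \<Longrightarrow> 0 < E \<Longrightarrow> 0 < T \<Longrightarrow>
      search_evolution hbar E e m (\<lambda>s. s) T psi \<Longrightarrow>
      search_error e m psi \<le> 2 * (sqrt (real N - 1) / real N) / (E * T / hbar) + K / (E * T / hbar)\<^sup>2"
    using search_error_bound by blast
  fix Psi :: "real \<Rightarrow> real \<Rightarrow> complex ^ 'n"
  assume ev: "\<forall>T>0. search_evolution hbar E e m (\<lambda>s. s) T (\<lambda>s. Psi s T)"
  \<comment> \<open>The remainder \<open>K / (E * T / hbar)\<^sup>2\<close> with its dependence on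
    \<open>T\<close> isolated.\<close>
  define R where "R = (\<lambda>T. K * (hbar / E)\<^sup>2 * (1 / T\<^sup>2))"
  show "\<exists>R \<in> O[at_top](\<lambda>T::real. 1 / T\<^sup>2). \<forall>T>0. search_error e m (\<lambda>s. Psi s T)
      \<le> hbar / (E * T) * (2 * sqrt (real N - 1) / real N) + R T"
  proof (intro bexI allI impI)
    show "R \<in> O[at_top](\<lambda>T. 1 / T\<^sup>2)" 
      unfolding R_def
      by (rule bigoI[where c = "norm (K * (hbar / E)\<^sup>2)"], rule always_eventually, rule allI,
          rule norm_mult_ineq)
    fix T :: real
    assume "T > 0"
    then have "search_error e m (\<lambda>s. Psi s T)
        \<le> 2 * (sqrt (real N - 1) / real N) / (E * T / hbar) + K / (E * T / hbar)\<^sup>2"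
      using K assms ev by blast
    also have "\<dots> = hbar / (E * T) * (2 * sqrt (real N - 1) / real N) + R T"
      by (simp add: R_def power_divide power_mult_distrib mult_ac)
    finally show "search_error e m (\<lambda>s. Psi s T)
        \<le> hbar / (E * T) * (2 * sqrt (real N - 1) / real N) + R T" .
  qed
qed

end
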